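(* For any positive constants $\alpha_1,\alpha_2$ there is a positive constant $C=C(\alpha_1,\alpha_2)$ such that the following holds. Let $A$ be an $n\times n$ real (deterministic) matrix with singular values $\sigma_1\ge\sigma_2\ge\dots\ge\sigma_n\ge 0$, put $\delta:=\sigma_1-\sigma_2$ and assume $\delta>0$. Assume that $A$ has rank $r\le n^{1-\alpha_1}$ and that $\sigma_1\le n^{\alpha_2}$. Let $E$ be an $n\times n$ random Bernoulli matrix. Let $v_1$ and $v_1'$ be first unit singular vectors of $A$ and of $A+E$, respectively. Then with probability $1-o(1)$ $$\sin^2\angle(v_1,v_1')\le C\max\Big(\frac{\sqrt{r\log n}}{\delta},\ \frac{n}{\delta\sigma_1},\ \frac{\sqrt n}{\sigma_1}\Big).$$ Furthermore, if $\delta\le\frac12\sigma_1$, the term $\frac{\sqrt n}{\sigma_1}$ can be removed, i.e. with probability $1-o(1)$ $$\sin^2\angle(v_1,v_1')\le C\max\Big(\frac{\sqrt{r\log n}}{\delta},\ \frac{n}{\delta\sigma_1}\Big).$$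
   Context: A random Bernoulli matrix of size $n$ is an $n\times n$ matrix whose entries are iid random variables taking values $+1$ and $-1$ with probability $1/2$ each. For a square matrix $M$ with singular values $\sigma_1(M)\ge\dots\ge\sigma_n(M)$, the corresponding unit singular vectors are the right singular vectors, i.e. an orthonormal basis of eigenvectors of $M^{*}M$ with eigenvalues $\sigma_i(M)^2$; a "first" singular vector corresponds to $\sigma_1(M)$. For unit vectors $v,v'$, $\angle(v,v')$ is the angle between them taken in $[0,\pi/2]$ (so the sign ambiguity of singular vectors is irrelevant), i.e. $\sin^2\angle(v,v')=1-(v\cdot v')^2$. Asymptotic notation is as $n\to\infty$; "with probability $1-o(1)$" means that the probability of the event is at least $1-p_n$ for some sequence $p_n\to0$ depending only on the constants of the statement ($\alpha_1,\alpha_2$) and not on the particular matrix $A=A_n$. *)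

theory Defs
  imports
    "HOL-Probability.Probability"
    "Jordan_Normal_Form.DL_Rank"
    "Jordan_Normal_Form.Char_Poly"
begin

text \<open>
  Matrices and vectors are those of \<^theory>\<open>Jordan_Normal_Form.Matrix\<close>, since the dimension
  varies inside the statement. Some names are qualified because HOL-Analysis uses them as well.
\<close>

text \<open>
  The singular values in decreasing order, with multiplicity: the square roots of the roots of the
  characteristic polynomial of \<open>M\<^sup>T M\<close>. As this matrix is real symmetric and positive
  semidefinite, the list has \<open>dim_col M\<close> entries.
\<close>

definition singular_values :: "real mat \<Rightarrow> real list" where
  "singular_values M =
     rev (map sqrt (sorted_list_of_multiset (proots (char_poly (transpose_mat M * M)))))"

text \<open>
  Counting starts at 1, as in \<open>\<sigma>\<^sub>1, \<sigma>\<^sub>2, \<dots>\<close>; the value is meaningful for \<open>1 \<le> i \<le> dim_col M\<close> only.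
\<close>

definition singular_value :: "real mat \<Rightarrow> nat \<Rightarrow> real" where
  "singular_value M i = singular_values M ! (i - 1)"

text \<open>
  Unit right singular vectors for \<open>\<sigma>\<^sub>1\<close>. If \<open>\<sigma>\<^sub>1\<close> is a multiple singular value, every unit vector
  of the eigenspace qualifies, i.e. every possible first member of an orthonormal basis of
  right singular vectors.
\<close>

definition first_unit_singular_vector :: "real mat \<Rightarrow> real vec \<Rightarrow> bool" where
  "first_unit_singular_vector M v \<longleftrightarrow>
     eigenvector (transpose_mat M * M) v ((singular_value M 1)\<^sup>2) \<and> scalar_prod v v = 1"

text \<open>
  The angle in \<open>[0, \<pi>/2]\<close> between the lines spanned by two \<^emph>\<open>unit\<close> vectors; the absolute value
  removes the dependence on signs.
\<close>

definition unit_vec_angle :: "real vec \<Rightarrow> real vec \<Rightarrow> real" where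
  "unit_vec_angle v w = arccos \<bar>scalar_prod v w\<bar>"

text \<open>
  The law of a matrix with iid entries uniform on \<open>{-1, 1}\<close>. The second argument of
  \<^const>\<open>Pi_pmf\<close> is the value outside the index set and is not seen by the matrix.
\<close>

definition bernoulli_matrix :: "nat \<Rightarrow> real mat pmf" where
  "bernoulli_matrix n =
     map_pmf (Matrix.mat n n)
       (Pi_pmf ({..<n} \<times> {..<n}) 0 (\<lambda>_. pmf_of_set {-1, 1}))"

end

theory Submission imports Defs begin

text \<open>
  Let \<open>v, u\<close> and \<open>v', u'\<close> be the first right and left singular vectors of \<open>A\<close> and \<open>A + E\<close>. Then
  \<open>\<sigma>\<^sub>1(A + E) \<ge> u \<bullet> (A + E) v = \<sigma>\<^sub>1 + u \<bullet> E v\<close>, whereas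
  \<open>\<sigma>\<^sub>1(A + E) = u' \<bullet> A v' + u' \<bullet> E v'\<close> with \<open>u' \<bullet> A v' \<le> \<sigma>\<^sub>1 - \<delta> sin\<^sup>2(v, v') / 2\<close>. So it suffices to
  bound the two perturbation terms. A net argument with Hoeffding's inequality bounds \<open>E\<close>, as a
  bilinear form, by \<open>O(sqrt (r log n))\<close> on column space times row space of \<open>A\<close> and by \<open>O(sqrt n)\<close> on
  the whole space. Since \<open>A\<close> maps into its column space, the component of \<open>u'\<close> orthogonal to it has
  norm at most \<open>\<parallel>E\<parallel> / \<sigma>\<^sub>1(A + E)\<close>, and likewise for \<open>v'\<close> and the row space; these components contribute
  \<open>O(n / \<sigma>\<^sub>1)\<close>. If \<open>\<sigma>\<^sub>1 = O(sqrt n)\<close>, the term \<open>n / (\<delta> \<sigma>\<^sub>1)\<close> makes the claim trivial. In particular the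
  term \<open>sqrt n / \<sigma>\<^sub>1\<close> is never needed.
\<close>

unbundle no inner_syntax
unbundle no vec_syntax

subsection \<open>Tail bounds and nets\<close>

lemma rademacher_sum_tail:
  fixes w :: "'a \<Rightarrow> real"
  assumes I: "finite I" and w: "(\<Sum>e\<in>I. (w e)\<^sup>2) \<le> 1" and t: "t > 0"
  shows "measure_pmf.prob (Pi_pmf I 0 (\<lambda>_. pmf_of_set {-1, 1 :: real}))
           {f. t \<le> \<bar>\<Sum>e\<in>I. w e * f e\<bar>} \<le> 2 * exp (- t\<^sup>2 / 2)"
proof (cases "(\<Sum>e\<in>I. (w e)\<^sup>2) > 0")
  case False
  then have "(\<Sum>e\<in>I. (w e)\<^sup>2) = 0"
    by (simp add: order_antisym sum_nonneg)
  then have "w e = 0" if "e \<in> I" for e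
    using I that by (simp add: sum_nonneg_eq_0_iff)
  then have "{f. t \<le> \<bar>\<Sum>e\<in>I. w e * f e\<bar>} = {}"
    using t by auto
  then show ?thesis by simp
next
  case True
  let ?M = "Pi_pmf I 0 (\<lambda>_. pmf_of_set {-1, 1 :: real})"
  define X where "X = (\<lambda>e f. w e * f e :: real)"
  have supp: "set_pmf (pmf_of_set {-1, 1 :: real}) = {-1, 1}"
    by (rule set_pmf_of_set) auto
  have zero: "measure_pmf.expectation ?M (X e) = 0" if "e \<in> I" for e
  proof -
    have "measure_pmf.expectation ?M (X e)
      = w e * measure_pmf.expectation (map_pmf (\<lambda>f. f e) ?M) (\<lambda>x. x)"
      by (simp add: X_def)
    also have "map_pmf (\<lambda>f. f e) ?M = pmf_of_set {-1, 1}"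
      using I that by (simp add: Pi_pmf_component)
    also have "measure_pmf.expectation \<dots> (\<lambda>x. x) = 0"
      by (simp add: integral_pmf_of_set)
    finally show ?thesis by simp
  qed
  interpret Hoeffding_ineq "measure_pmf ?M" I X "\<lambda>e. - \<bar>w e\<bar>" "\<lambda>e. \<bar>w e\<bar>" 0
  proof unfold_locales
    show "finite I" by (rule I)
    show "prob_space.indep_vars ?M (\<lambda>_. borel) X I"
      unfolding X_def
      by (rule prob_space.indep_vars_compose2[OF measure_pmf.prob_space_axioms
            indep_vars_Pi_pmf[OF I]]) simp_all
    fix e assume "e \<in> I"
    show "AE f in ?M. X e f \<in> {- \<bar>w e\<bar>..\<bar>w e\<bar>}"
    proof (rule AE_pmfI)
      fix f assume "f \<in> set_pmf ?M"
      then have "f e \<in> {-1, 1}"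
        using \<open>e \<in> I\<close> I supp by (auto simp: set_Pi_pmf PiE_dflt_def)
      then show "X e f \<in> {- \<bar>w e\<bar>..\<bar>w e\<bar>}"
        by (auto simp: X_def)
    qed
  next
    show "0 \<equiv> \<Sum>e\<in>I. measure_pmf.expectation ?M (X e)"
      by (simp add: zero)
  qed
  have four: "(\<Sum>e\<in>I. (\<bar>w e\<bar> - - \<bar>w e\<bar>)\<^sup>2) = 4 * (\<Sum>e\<in>I. (w e)\<^sup>2)"
    by (simp add: sum_distrib_left power2_eq_square)
  have "measure_pmf.prob ?M {f \<in> space ?M. t \<le> \<bar>(\<Sum>e\<in>I. X e f) - 0\<bar>}
      \<le> 2 * exp (- 2 * t\<^sup>2 / (\<Sum>e\<in>I. (\<bar>w e\<bar> - - \<bar>w e\<bar>)\<^sup>2))"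
    by (rule Hoeffding_ineq_abs_ge) (use t True four in auto)
  also have "- 2 * t\<^sup>2 / (\<Sum>e\<in>I. (\<bar>w e\<bar> - - \<bar>w e\<bar>)\<^sup>2) = - (t\<^sup>2 / 2) / (\<Sum>e\<in>I. (w e)\<^sup>2)"
    unfolding four by (simp add: field_simps)
  also have "\<dots> \<le> - t\<^sup>2 / 2"
    using True w by (simp add: field_simps mult_left_le)
  finally show ?thesis by (simp add: X_def)
qed

definition lattice_net :: "nat \<Rightarrow> (nat \<Rightarrow> int) set" where
  "lattice_net m = {z \<in> {..<m} \<rightarrow>\<^sub>E {-16 * int m..16 * int m}. (\<Sum>i<m. (z i)\<^sup>2) \<le> 16 * int m}"

lemma finite_lattice_net: "finite (lattice_net m)"
  unfolding lattice_net_def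
  by (rule finite_subset[of _ "{..<m} \<rightarrow>\<^sub>E {-16 * int m..16 * int m}"]) (auto intro: finite_PiE)

lemma abs_le_square_int: "\<bar>j\<bar> \<le> (j :: int)\<^sup>2"
  using self_le_power[of "\<bar>j\<bar>" 2] by (cases "j = 0") auto

lemma sum_two_powers_le: "(\<Sum>j\<in>{- int k..int k}. (1/2 :: real) ^ nat \<bar>j\<bar>) \<le> 3"
proof -
  have "(\<Sum>j\<in>{- int k..int k}. (1/2 :: real) ^ nat \<bar>j\<bar>) = 3 - 2 * (1/2) ^ k"
  proof (induction k)
    case (Suc k)
    have "{- int (Suc k)..int (Suc k)} = insert (- int (Suc k)) (insert (int (Suc k)) {- int k..int k})"
      by auto
    then show ?case using Suc by (simp add: nat_add_distrib)
  qed auto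
  then show ?thesis by simp
qed

text \<open>Each lattice point has weight at least \<open>2 powr (-16 m)\<close> under \<open>\<Prod>i. 2 powr (-\<bar>z i\<bar>)\<close>,
  while the total weight of \<open>\<int>\<^sup>m\<close> is \<open>3\<^sup>m\<close>.\<close>

lemma card_lattice_net: "real (card (lattice_net m)) \<le> exp (18 * real m)"
proof -
  have "real (card (lattice_net m)) * (1/2) ^ (16 * m)
    = (\<Sum>z\<in>lattice_net m. (1/2 :: real) ^ (16 * m))" by simp
  also have "\<dots> \<le> (\<Sum>z\<in>lattice_net m. \<Prod>i<m. (1/2) ^ nat \<bar>z i\<bar>)"
  proof (rule sum_mono)
    fix z assume "z \<in> lattice_net m"
    then have "(\<Sum>i<m. (z i)\<^sup>2) \<le> 16 * int m" by (simp add: lattice_net_def)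
    moreover have "(\<Sum>i<m. \<bar>z i\<bar>) \<le> (\<Sum>i<m. (z i)\<^sup>2)"
      by (intro sum_mono abs_le_square_int)
    ultimately have "(\<Sum>i<m. nat \<bar>z i\<bar>) \<le> 16 * m"
      by (simp add: nat_le_iff flip: of_nat_le_iff[where 'a = int])
    then show "(1/2 :: real) ^ (16 * m) \<le> (\<Prod>i<m. (1/2) ^ nat \<bar>z i\<bar>)"
      by (simp add: power_sum[symmetric] power_decreasing)
  qed
  also have "\<dots> \<le> (\<Sum>z\<in>{..<m} \<rightarrow>\<^sub>E {-16 * int m..16 * int m}. \<Prod>i<m. (1/2 :: real) ^ nat \<bar>z i\<bar>)"
  proof (rule sum_mono2)
    show "finite ({..<m} \<rightarrow>\<^sub>E {-16 * int m..16 * int m})"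
      by (rule finite_PiE) simp_all
  qed (simp_all add: lattice_net_def prod_nonneg)
  also have "\<dots> = (\<Prod>i<m. \<Sum>j\<in>{-16 * int m..16 * int m}. (1/2 :: real) ^ nat \<bar>j\<bar>)"
    by (rule prod_sum_PiE[symmetric]) auto
  also have "\<dots> \<le> (\<Prod>i<m. 3)"
    using sum_two_powers_le[of "16 * m"] by (intro prod_mono) (auto intro!: sum_nonneg)
  finally have le: "real (card (lattice_net m)) * (1/2) ^ (16 * m) \<le> 3 ^ m"
    by simp
  have "real (card (lattice_net m)) = real (card (lattice_net m)) * (1/2) ^ (16 * m) * 2 ^ (16 * m)"
    by (simp add: power_one_over)
  also have "\<dots> \<le> 3 ^ m * 2 ^ (16 * m)"
    by (intro mult_right_mono le) simp
  also have "\<dots> = (3 * 2 ^ 16) ^ m"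
    by (simp only: power_mult_distrib power_mult)
  also have "\<dots> \<le> exp 18 ^ m"
  proof (rule power_mono)
    have "(2 :: real) ^ 18 \<le> exp 1 ^ 18"
      using exp_ge_add_one_self[of 1] by (intro power_mono) auto
    also have "exp 1 ^ 18 = exp (18 :: real)"
      using exp_of_nat_mult[of 18 "1 :: real"] by simp
    finally show "(3 * 2 ^ 16 :: real) \<le> exp 18" by simp
  qed simp
  finally show ?thesis using exp_of_nat_mult[of m "18 :: real"] by (simp add: mult.commute)
qed

definition net_point :: "nat \<Rightarrow> (nat \<Rightarrow> int) \<Rightarrow> nat \<Rightarrow> real" where
  "net_point m z i = real_of_int (z i) / (4 * sqrt (real m))"

lemma net_point_norm:
  assumes "z \<in> lattice_net m"
  shows "(\<Sum>i<m. (net_point m z i)\<^sup>2) \<le> 1"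
proof (cases "m = 0")
  case False
  have "(\<Sum>i<m. (net_point m z i)\<^sup>2) = (\<Sum>i<m. (real_of_int (z i))\<^sup>2) / (16 * real m)"
    by (simp add: net_point_def power_divide power_mult_distrib sum_divide_distrib)
  also have "(\<Sum>i<m. (real_of_int (z i))\<^sup>2) = real_of_int (\<Sum>i<m. (z i)\<^sup>2)" by simp
  also have "\<dots> \<le> real_of_int (16 * int m)"
    using assms unfolding lattice_net_def of_int_le_iff by auto
  finally show ?thesis using False by (simp add: divide_simps)
qed simp

lemma ex_net_point:
  fixes x :: "nat \<Rightarrow> real"
  assumes x: "(\<Sum>i<m. (x i)\<^sup>2) \<le> 1"
  obtains z where "z \<in> lattice_net m" "(\<Sum>i<m. (x i - net_point m z i)\<^sup>2) \<le> 1 / 16"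
proof (cases "m = 0")
  case True
  then have "restrict (\<lambda>_. 0) {..<m} \<in> lattice_net m" by (simp add: lattice_net_def)
  then show ?thesis using that True by auto
next
  case False
  define s where "s = 4 * sqrt (real m)"
  have s: "s > 0" "s\<^sup>2 = 16 * real m"
    using False by (auto simp: s_def power_mult_distrib)
  \<comment> \<open>Rounding towards 0, so that the norm does not increase.\<close>
  define g where "g = (\<lambda>y::real. if 0 \<le> y then \<lfloor>y\<rfloor> else \<lceil>y\<rceil>)"
  have g: "\<bar>real_of_int (g y)\<bar> \<le> \<bar>y\<bar>" "\<bar>y - real_of_int (g y)\<bar> \<le> 1" for y
    unfolding g_def by (cases "0 \<le> y"; simp; linarith)+
  define z where "z = restrict (\<lambda>i. g (s * x i)) {..<m}"
  have "(\<Sum>i<m. (real_of_int (z i))\<^sup>2) \<le> (\<Sum>i<m. (s * x i)\<^sup>2)"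
    using g(1) by (intro sum_mono) (simp add: z_def abs_le_square_iff[symmetric])
  also have "\<dots> = 16 * real m * (\<Sum>i<m. (x i)\<^sup>2)"
    by (simp add: power_mult_distrib s(2) sum_distrib_left)
  also have "\<dots> \<le> 16 * real m"
    using x by (simp add: mult_left_le)
  finally have "real_of_int (\<Sum>i<m. (z i)\<^sup>2) \<le> real_of_int (16 * int m)" by simp
  then have sq: "(\<Sum>i<m. (z i)\<^sup>2) \<le> 16 * int m"
    unfolding of_int_le_iff .
  have "\<bar>z i\<bar> \<le> 16 * int m" if "i < m" for i
  proof -
    have "\<bar>z i\<bar> \<le> (z i)\<^sup>2"
      by (rule abs_le_square_int)
    also have "\<dots> \<le> (\<Sum>i<m. (z i)\<^sup>2)"
      using that by (intro member_le_sum) auto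
    finally show ?thesis using sq by linarith
  qed
  then have "z \<in> lattice_net m"
    using sq by (auto simp: lattice_net_def z_def abs_le_iff minus_le_iff)
  moreover have "(\<Sum>i<m. (x i - net_point m z i)\<^sup>2) \<le> (\<Sum>i<m. 1 / s\<^sup>2)"
  proof (rule sum_mono)
    fix i assume i: "i \<in> {..<m}"
    have "x i - net_point m z i = (s * x i - real_of_int (g (s * x i))) / s"
      using i s(1) by (simp add: z_def net_point_def s_def[symmetric] diff_divide_distrib)
    moreover have "(s * x i - real_of_int (g (s * x i)))\<^sup>2 \<le> 1"
      using g(2)[of "s * x i"] by (simp add: abs_square_le_1)
    ultimately show "(x i - net_point m z i)\<^sup>2 \<le> 1 / s\<^sup>2"
      by (simp add: power_divide divide_right_mono)
  qed
  moreover have "(\<Sum>i<m. 1 / s\<^sup>2) = 1 / 16"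
    using False by (simp add: s(2))
  ultimately show ?thesis using that[of z] by linarith
qed

definition vnorm :: "real vec \<Rightarrow> real" where
  "vnorm x = sqrt (x \<bullet> x)"

lemma scalar_prod_self: "x \<bullet> (x :: real vec) = (\<Sum>i<dim_vec x. (x $ i)\<^sup>2)"
  by (simp add: scalar_prod_def power2_eq_square atLeast0LessThan)

lemma scalar_prod_self_nonneg [simp]: "0 \<le> x \<bullet> (x :: real vec)"
  by (simp add: scalar_prod_self sum_nonneg)

lemma vnorm_nonneg [simp]: "0 \<le> vnorm x"
  by (simp add: vnorm_def)

lemma vnorm_square: "(vnorm x)\<^sup>2 = x \<bullet> x"
  by (simp add: vnorm_def)

lemma vnorm_eq_0_iff: "x \<in> carrier_vec n \<Longrightarrow> vnorm x = 0 \<longleftrightarrow> x = 0\<^sub>v n"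
  by (auto simp: vnorm_def scalar_prod_self sum_nonneg_eq_0_iff)

lemma vnorm_smult: "vnorm (c \<cdot>\<^sub>v x) = \<bar>c\<bar> * vnorm x"
  by (simp add: vnorm_def real_sqrt_mult flip: mult.assoc)

lemma square_le_of_quadratic_nonneg:
  fixes a b c :: real
  assumes "\<And>t. 0 \<le> a + 2 * b * t + c * t\<^sup>2"
  shows "b\<^sup>2 \<le> a * c"
proof (cases "c = 0")
  case True
  show ?thesis
  proof (cases "b = 0")
    case False
    then show ?thesis using assms[of "- (a + 1) / (2 * b)"] True by simp
  qed (simp add: True)
next
  case False
  have "c > 0"
  proof (rule ccontr)
    assume "\<not> c > 0"
    then have c: "c < 0" using False by simp
    define t where "t = 1 + \<bar>2 * b\<bar> / \<bar>c\<bar> + \<bar>a\<bar> / \<bar>c\<bar>"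
    have "\<bar>c\<bar> * t = \<bar>c\<bar> + \<bar>2 * b\<bar> + \<bar>a\<bar>" using False by (simp add: t_def field_simps)
    then have "c * t\<^sup>2 = - (\<bar>c\<bar> + \<bar>2 * b\<bar> + \<bar>a\<bar>) * t"
      using c by (simp add: power2_eq_square flip: mult.assoc)
    moreover have "t \<ge> 1" by (simp add: t_def)
    ultimately have "a + 2 * b * t + c * t\<^sup>2 \<le> a + 2 * b * t - \<bar>2 * b\<bar> * t - \<bar>c\<bar> - \<bar>a\<bar>"
      using mult_right_mono[of 1 t "\<bar>c\<bar>"] mult_right_mono[of 1 t "\<bar>a\<bar>"]
      by (simp add: algebra_simps)
    also have "\<dots> < 0"
      using mult_right_mono[of "2 * b" "\<bar>2 * b\<bar>" t] \<open>t \<ge> 1\<close> c by linarith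
    finally show False using assms[of t] by simp
  qed
  have "0 \<le> c * (a + 2 * b * (- b / c) + c * (- b / c)\<^sup>2)"
    using assms[of "- b / c"] \<open>c > 0\<close> by (intro mult_nonneg_nonneg) auto
  also have "\<dots> = a * c - b\<^sup>2"
    using False by (simp add: field_simps power2_eq_square)
  finally show ?thesis by simp
qed

lemma psd_Cauchy_Schwarz:
  fixes H :: "real mat"
  assumes H: "H \<in> carrier_mat n n" and sym: "transpose_mat H = H"
    and psd: "\<And>x. x \<in> carrier_vec n \<Longrightarrow> 0 \<le> x \<bullet> (H *\<^sub>v x)"
    and x: "x \<in> carrier_vec n" and y: "y \<in> carrier_vec n"
  shows "(x \<bullet> (H *\<^sub>v y))\<^sup>2 \<le> (x \<bullet> (H *\<^sub>v x)) * (y \<bullet> (H *\<^sub>v y))"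
proof (rule square_le_of_quadratic_nonneg)
  fix t :: real
  have "y \<bullet> (H *\<^sub>v x) = x \<bullet> (H *\<^sub>v y)"
    using transpose_vec_mult_scalar[OF H x y] sym H x y
    by (metis comm_scalar_prod mult_mat_vec_carrier)
  then have "((x + t \<cdot>\<^sub>v y) \<bullet> (H *\<^sub>v (x + t \<cdot>\<^sub>v y)))
    = (x \<bullet> (H *\<^sub>v x)) + 2 * (x \<bullet> (H *\<^sub>v y)) * t + (y \<bullet> (H *\<^sub>v y)) * t\<^sup>2"
    using H x y
    by (simp add: mult_add_distrib_mat_vec[OF H] mult_mat_vec[OF H]
        add_scalar_prod_distrib[of _ n] scalar_prod_add_distrib[of _ n] algebra_simps power2_eq_square)
  then show "0 \<le> (x \<bullet> (H *\<^sub>v x)) + 2 * (x \<bullet> (H *\<^sub>v y)) * t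
      + (y \<bullet> (H *\<^sub>v y)) * t\<^sup>2"
    using psd[of "x + t \<cdot>\<^sub>v y"] x y by simp
qed

lemma vec_Cauchy_Schwarz:
  assumes x: "x \<in> carrier_vec n" and y: "y \<in> carrier_vec n"
  shows "\<bar>x \<bullet> y\<bar> \<le> vnorm x * vnorm y"
proof -
  have "(x \<bullet> (1\<^sub>m n *\<^sub>v y))\<^sup>2
      \<le> (x \<bullet> (1\<^sub>m n *\<^sub>v x)) * (y \<bullet> (1\<^sub>m n *\<^sub>v y))"
    by (rule psd_Cauchy_Schwarz[of _ n]) (use x y in auto)
  then have "(x \<bullet> y)\<^sup>2 \<le> (vnorm x * vnorm y)\<^sup>2"
    using x y by (simp add: vnorm_square power_mult_distrib)
  then show ?thesis
    using abs_le_square_iff[of "x \<bullet> y" "vnorm x * vnorm y"] by (simp add: abs_mult)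
qed

lemma bilinear_bound_ex:
  fixes M :: "real mat"
  assumes M: "M \<in> carrier_mat k l"
  obtains c where "c > 0"
    "\<And>x y. x \<in> carrier_vec k \<Longrightarrow> y \<in> carrier_vec l \<Longrightarrow>
       \<bar>x \<bullet> (M *\<^sub>v y)\<bar> \<le> c * vnorm x * vnorm y"
    "\<And>y. y \<in> carrier_vec l \<Longrightarrow> vnorm (M *\<^sub>v y) \<le> c * vnorm y"
proof -
  define c where "c = 1 + (\<Sum>i<k. vnorm (row M i))"
  have "c > 0" unfolding c_def by (intro add_pos_nonneg sum_nonneg) auto
  have *: "vnorm (M *\<^sub>v y) \<le> c * vnorm y" if y: "y \<in> carrier_vec l" for y
  proof -
    have "vnorm (M *\<^sub>v y) = L2_set (\<lambda>i. ((row M i) \<bullet> y)) {..<k}"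
      using M y by (simp add: vnorm_def L2_set_def scalar_prod_self)
    also have "\<dots> \<le> (\<Sum>i<k. \<bar>(row M i) \<bullet> y\<bar>)"
      by (rule L2_set_le_sum_abs)
    also have "\<dots> \<le> (\<Sum>i<k. vnorm (row M i) * vnorm y)"
      using M y by (intro sum_mono vec_Cauchy_Schwarz[of _ l]) auto
    also have "\<dots> \<le> c * vnorm y"
      by (simp add: c_def sum_distrib_left algebra_simps)
    finally show ?thesis .
  qed
  have "\<bar>x \<bullet> (M *\<^sub>v y)\<bar> \<le> c * vnorm x * vnorm y"
    if x: "x \<in> carrier_vec k" and y: "y \<in> carrier_vec l" for x y
  proof -
    have "\<bar>x \<bullet> (M *\<^sub>v y)\<bar> \<le> vnorm x * vnorm (M *\<^sub>v y)"
      using M x y by (intro vec_Cauchy_Schwarz[of _ k]) auto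
    also have "\<dots> \<le> vnorm x * (c * vnorm y)"
      by (intro mult_left_mono *) (use y in auto)
    finally show ?thesis by (simp add: mult_ac)
  qed
  with * \<open>c > 0\<close> show ?thesis using that by blast
qed

abbreviation net_vec :: "nat \<Rightarrow> (nat \<Rightarrow> int) \<Rightarrow> real vec" where
  "net_vec m z \<equiv> Matrix.vec m (net_point m z)"

lemma net_vec_norm: "z \<in> lattice_net m \<Longrightarrow> vnorm (net_vec m z) \<le> 1"
  using net_point_norm[of z m] by (simp add: vnorm_def scalar_prod_self)

lemma ex_net_vec:
  assumes x: "x \<in> carrier_vec m" and n: "vnorm x \<le> 1"
  obtains z where "z \<in> lattice_net m" "vnorm (x - net_vec m z) \<le> 1 / 4"
proof -
  have "(\<Sum>i<m. (x $ i)\<^sup>2) \<le> 1"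
    using n x by (simp add: vnorm_def scalar_prod_self)
  then obtain z where z: "z \<in> lattice_net m" "(\<Sum>i<m. (x $ i - net_point m z i)\<^sup>2) \<le> 1 / 16"
    by (rule ex_net_point)
  have "vnorm (x - net_vec m z) \<le> sqrt (1 / 16)"
    using z(2) x unfolding vnorm_def by (intro real_sqrt_le_mono) (simp add: scalar_prod_self)
  then show ?thesis using that z(1) by (simp add: real_sqrt_divide)
qed

lemma bilinear_bound_from_net:
  fixes M :: "real mat"
  assumes M: "M \<in> carrier_mat k l"
    and net: "\<And>a b. a \<in> lattice_net k \<Longrightarrow> b \<in> lattice_net l \<Longrightarrow>
      \<bar>(net_vec k a) \<bullet> (M *\<^sub>v net_vec l b)\<bar> \<le> t"
    and x: "x \<in> carrier_vec k" and y: "y \<in> carrier_vec l"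
  shows "\<bar>x \<bullet> (M *\<^sub>v y)\<bar> \<le> 2 * t * vnorm x * vnorm y"
proof -
  define D where "D = (\<lambda>m. {x :: real vec. x \<in> carrier_vec m \<and> vnorm x \<le> 1})"
  define S where "S = (\<lambda>(x, y). \<bar>x \<bullet> (M *\<^sub>v y)\<bar>) ` (D k \<times> D l)"
  define s where "s = Sup S"
  have zero: "0\<^sub>v m \<in> D m" for m by (simp add: D_def vnorm_def)
  obtain c where c: "c > 0" and cb: "\<And>x y. x \<in> carrier_vec k \<Longrightarrow> y \<in> carrier_vec l \<Longrightarrow>
       \<bar>x \<bullet> (M *\<^sub>v y)\<bar> \<le> c * vnorm x * vnorm y"
    using bilinear_bound_ex[OF M] by metis
  have bdd: "bdd_above S"
  proof (rule bdd_aboveI)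
    fix r assume "r \<in> S"
    then obtain x y where xy: "x \<in> D k" "y \<in> D l" "r = \<bar>x \<bullet> (M *\<^sub>v y)\<bar>"
      by (auto simp: S_def)
    then have "r \<le> c * (vnorm x * vnorm y)" using cb[of x y] by (auto simp: D_def mult.assoc)
    also have "\<dots> \<le> c * 1"
      using xy c by (intro mult_left_mono mult_le_one) (auto simp: D_def)
    finally show "r \<le> c" by simp
  qed
  have sup: "\<bar>x \<bullet> (M *\<^sub>v y)\<bar> \<le> s" if "x \<in> D k" "y \<in> D l" for x y
    unfolding s_def by (rule cSup_upper[OF _ bdd]) (use that in \<open>auto simp: S_def\<close>)
  have "0 \<le> s" using sup[OF zero zero] by linarith
  have scale: "\<bar>x \<bullet> (M *\<^sub>v y)\<bar> \<le> s * vnorm x * vnorm y"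
    if x: "x \<in> carrier_vec k" and y: "y \<in> carrier_vec l" for x y
  proof (cases "vnorm x = 0 \<or> vnorm y = 0")
    case True
    then show ?thesis using cb[OF x y] by auto
  next
    case False
    then have "(1 / vnorm x) \<cdot>\<^sub>v x \<in> D k" "(1 / vnorm y) \<cdot>\<^sub>v y \<in> D l"
      using x y by (auto simp: D_def vnorm_smult)
    from sup[OF this] have "\<bar>(1 / vnorm x) * ((1 / vnorm y) * (x \<bullet> (M *\<^sub>v y)))\<bar> \<le> s"
      using M x y by (simp add: mult_mat_vec[OF M] mult_ac)
    then have "\<bar>x \<bullet> (M *\<^sub>v y)\<bar> / (vnorm x * vnorm y) \<le> s"
      by (simp add: abs_mult mult.commute)
    moreover have "0 < vnorm x * vnorm y"
      using False by (simp add: less_le)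
    ultimately show ?thesis by (simp add: pos_divide_le_eq mult.assoc)
  qed
  have "s \<le> t + s / 2"
    unfolding s_def
  proof (rule cSup_least)
    show "S \<noteq> {}" using zero by (auto simp: S_def)
    fix r assume "r \<in> S"
    then obtain x y where xy: "x \<in> carrier_vec k" "vnorm x \<le> 1" "y \<in> carrier_vec l" "vnorm y \<le> 1"
        and r: "r = \<bar>x \<bullet> (M *\<^sub>v y)\<bar>"
      by (auto simp: S_def D_def)
    obtain a where a: "a \<in> lattice_net k" "vnorm (x - net_vec k a) \<le> 1 / 4"
      using ex_net_vec xy by blast
    obtain b where b: "b \<in> lattice_net l" "vnorm (y - net_vec l b) \<le> 1 / 4"
      using ex_net_vec xy by blast
    define p q where "p = net_vec k a" and "q = net_vec l b"
    have pq: "p \<in> carrier_vec k" "q \<in> carrier_vec l" "vnorm p \<le> 1"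
      using net_vec_norm a b by (auto simp: p_def q_def)
    have "x \<bullet> (M *\<^sub>v y) = p \<bullet> (M *\<^sub>v q)
        + ((x - p) \<bullet> (M *\<^sub>v y)) + (p \<bullet> (M *\<^sub>v (y - q)))"
      using M xy pq
      by (simp add: minus_scalar_prod_distrib[of _ k] mult_minus_distrib_mat_vec[OF M]
          scalar_prod_minus_distrib[of _ k])
    moreover have "\<bar>p \<bullet> (M *\<^sub>v q)\<bar> \<le> t"
      using net a b by (simp add: p_def q_def)
    moreover have "\<bar>(x - p) \<bullet> (M *\<^sub>v y)\<bar> \<le> s * (1 / 4)"
    proof -
      have "\<bar>(x - p) \<bullet> (M *\<^sub>v y)\<bar> \<le> s * (vnorm (x - p) * vnorm y)"
        using scale[of "x - p" y] xy pq by (simp add: mult.assoc)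
      also have "\<dots> \<le> s * (1 / 4 * 1)"
        using a xy \<open>0 \<le> s\<close> by (intro mult_left_mono mult_mono) (auto simp: p_def)
      finally show ?thesis by simp
    qed
    moreover have "\<bar>p \<bullet> (M *\<^sub>v (y - q))\<bar> \<le> s * (1 / 4)"
    proof -
      have "\<bar>p \<bullet> (M *\<^sub>v (y - q))\<bar> \<le> s * (vnorm p * vnorm (y - q))"
        using scale[of p "y - q"] xy pq by (simp add: mult.assoc)
      also have "\<dots> \<le> s * (1 * (1 / 4))"
        using b pq \<open>0 \<le> s\<close> by (intro mult_left_mono mult_mono) (auto simp: q_def)
      finally show ?thesis by simp
    qed
    ultimately show "r \<le> t + Sup S / 2"
      unfolding r s_def[symmetric] by linarith
  qed
  then have "s \<le> 2 * t" by simp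
  then have "s * (vnorm x * vnorm y) \<le> 2 * t * (vnorm x * vnorm y)"
    by (intro mult_right_mono) auto
  then show ?thesis using scale[OF x y] by (simp add: mult.assoc)
qed

definition orthonormal_cols :: "nat \<Rightarrow> nat \<Rightarrow> real mat \<Rightarrow> bool" where
  "orthonormal_cols n k Q \<longleftrightarrow> Q \<in> carrier_mat n k \<and> transpose_mat Q * Q = 1\<^sub>m k"

lemma orthonormal_cols_carrier: "orthonormal_cols n k Q \<Longrightarrow> Q \<in> carrier_mat n k"
  by (simp add: orthonormal_cols_def)

lemma scalar_prod_adjoint:
  fixes M :: "real mat"
  assumes "M \<in> carrier_mat n k" "x \<in> carrier_vec n" "y \<in> carrier_vec k"
  shows "x \<bullet> (M *\<^sub>v y) = (transpose_mat M *\<^sub>v x) \<bullet> y"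
  using transpose_vec_mult_scalar[OF assms(1,3,2)] assms
  by (metis comm_scalar_prod mult_mat_vec_carrier transpose_carrier_mat)

lemma orthonormal_cols_scalar_prod:
  assumes Q: "orthonormal_cols n k Q" and x: "x \<in> carrier_vec k" and y: "y \<in> carrier_vec k"
  shows "(Q *\<^sub>v x) \<bullet> (Q *\<^sub>v y) = x \<bullet> y"
proof -
  have C: "Q \<in> carrier_mat n k" "transpose_mat Q * Q = 1\<^sub>m k"
    using Q by (auto simp: orthonormal_cols_def)
  have "(Q *\<^sub>v x) \<bullet> (Q *\<^sub>v y) = (transpose_mat Q *\<^sub>v (Q *\<^sub>v x)) \<bullet> y"
    using C x y by (intro scalar_prod_adjoint) auto
  also have "transpose_mat Q *\<^sub>v (Q *\<^sub>v x) = x"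
    using C x by (metis assoc_mult_mat_vec one_mult_mat_vec transpose_carrier_mat)
  finally show ?thesis .
qed

lemma orthonormal_cols_vnorm:
  assumes "orthonormal_cols n k Q" "x \<in> carrier_vec k"
  shows "vnorm (Q *\<^sub>v x) = vnorm x"
  unfolding vnorm_def using orthonormal_cols_scalar_prod[OF assms assms(2)] by simp

lemma set_pmf_bernoulli_matrix: "set_pmf (bernoulli_matrix n) \<subseteq> carrier_mat n n"
  by (auto simp: bernoulli_matrix_def)

lemma bernoulli_bilinear_tail:
  assumes u: "u \<in> carrier_vec n" "vnorm u \<le> 1" and v: "v \<in> carrier_vec n" "vnorm v \<le> 1"
    and t: "t > 0"
  shows "measure_pmf.prob (bernoulli_matrix n) {E. t \<le> \<bar>u \<bullet> (E *\<^sub>v v)\<bar>} \<le> 2 * exp (- t\<^sup>2 / 2)"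
proof -
  let ?I = "{..<n} \<times> {..<n}"
  define w where "w = (\<lambda>(i, j). u $ i * v $ j)"
  have "u \<bullet> (Matrix.mat n n f *\<^sub>v v) = (\<Sum>e\<in>?I. w e * f e)" for f
  proof -
    have "u \<bullet> (Matrix.mat n n f *\<^sub>v v) = (\<Sum>i<n. u $ i * (\<Sum>j<n. f (i, j) * v $ j))"
      using u v by (simp add: scalar_prod_def atLeast0LessThan)
    also have "\<dots> = (\<Sum>i<n. \<Sum>j<n. w (i, j) * f (i, j))"
      by (simp add: w_def sum_distrib_left mult_ac)
    finally show ?thesis by (simp add: sum.cartesian_product)
  qed
  then have eq: "measure_pmf.prob (bernoulli_matrix n) {E. t \<le> \<bar>u \<bullet> (E *\<^sub>v v)\<bar>}
    = measure_pmf.prob (Pi_pmf ?I 0 (\<lambda>_. pmf_of_set {-1, 1})) {f. t \<le> \<bar>\<Sum>e\<in>?I. w e * f e\<bar>}"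
    by (simp add: bernoulli_matrix_def vimage_def)
  have "(\<Sum>e\<in>?I. (w e)\<^sup>2) = (\<Sum>i<n. \<Sum>j<n. (u $ i)\<^sup>2 * (v $ j)\<^sup>2)"
    by (simp add: w_def sum.cartesian_product split_def power_mult_distrib)
  also have "\<dots> = (vnorm u)\<^sup>2 * (vnorm v)\<^sup>2"
    using u v by (simp add: vnorm_square scalar_prod_self sum_product)
  also have "\<dots> \<le> 1"
    using u v by (intro mult_le_one power_le_one) auto
  finally have "(\<Sum>e\<in>?I. (w e)\<^sup>2) \<le> 1" .
  then show ?thesis
    unfolding eq by (intro rademacher_sum_tail t) auto
qed

lemma bernoulli_subspace_tail:
  assumes Q: "orthonormal_cols n k Q" and P: "orthonormal_cols n l P" and t: "t > 0"
  shows "measure_pmf.prob (bernoulli_matrix n)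
      {E. \<exists>x\<in>carrier_vec k. \<exists>y\<in>carrier_vec l.
          2 * t * vnorm x * vnorm y < \<bar>(Q *\<^sub>v x) \<bullet> (E *\<^sub>v (P *\<^sub>v y))\<bar>}
    \<le> 2 * exp (18 * real (k + l) - t\<^sup>2 / 2)"
    (is "measure_pmf.prob _ ?B \<le> _")
proof -
  let ?N = "lattice_net k \<times> lattice_net l"
  define B where "B = (\<lambda>(a, b). {E. t \<le> \<bar>(Q *\<^sub>v net_vec k a) \<bullet> (E *\<^sub>v (P *\<^sub>v net_vec l b))\<bar>})"
  note QC = orthonormal_cols_carrier[OF Q] and PC = orthonormal_cols_carrier[OF P]
  have sub: "E \<in> (\<Union>z\<in>?N. B z)" if E: "E \<in> carrier_mat n n" and bad: "E \<in> ?B" for E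
  proof (rule ccontr)
    assume "E \<notin> (\<Union>z\<in>?N. B z)"
    then have net: "\<bar>(Q *\<^sub>v net_vec k a) \<bullet> (E *\<^sub>v (P *\<^sub>v net_vec l b))\<bar> \<le> t"
      if "a \<in> lattice_net k" "b \<in> lattice_net l" for a b
      using that by (auto simp: B_def not_le intro: less_imp_le)
    define M where "M = transpose_mat Q * (E * P)"
    have MC: "M \<in> carrier_mat k l" using QC PC E by (auto simp: M_def)
    have M: "x \<bullet> (M *\<^sub>v y) = (Q *\<^sub>v x) \<bullet> (E *\<^sub>v (P *\<^sub>v y))"
      if "x \<in> carrier_vec k" "y \<in> carrier_vec l" for x y
    proof -
      have "M *\<^sub>v y = transpose_mat Q *\<^sub>v (E *\<^sub>v (P *\<^sub>v y))"
        using QC PC E that unfolding M_def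
        by (subst assoc_mult_mat_vec[of _ k n _ l]) (auto simp: assoc_mult_mat_vec[of E n n P l])
      then show ?thesis
        using QC PC E that by (simp add: scalar_prod_adjoint[of "transpose_mat Q" k n])
    qed
    have "\<bar>x \<bullet> (M *\<^sub>v y)\<bar> \<le> 2 * t * vnorm x * vnorm y"
      if "x \<in> carrier_vec k" "y \<in> carrier_vec l" for x y
      by (rule bilinear_bound_from_net[OF MC _ that]) (use net M in auto)
    then show False using bad M by fastforce
  qed
  have "measure_pmf.prob (bernoulli_matrix n) ?B
      \<le> measure_pmf.prob (bernoulli_matrix n) (\<Union>z\<in>?N. B z)"
  proof (rule measure_pmf.finite_measure_mono_AE)
    show "AE E in bernoulli_matrix n. E \<in> ?B \<longrightarrow> E \<in> (\<Union>z\<in>?N. B z)"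
    proof (rule AE_pmfI, rule impI)
      fix E assume "E \<in> set_pmf (bernoulli_matrix n)" "E \<in> ?B"
      then show "E \<in> (\<Union>z\<in>?N. B z)"
        using set_pmf_bernoulli_matrix[of n] by (intro sub) auto
    qed
  qed simp
  also have "\<dots> \<le> (\<Sum>z\<in>?N. measure_pmf.prob (bernoulli_matrix n) (B z))"
    by (intro measure_pmf.finite_measure_subadditive_finite) (auto simp: finite_lattice_net)
  also have "\<dots> \<le> (\<Sum>z\<in>?N. 2 * exp (- t\<^sup>2 / 2))"
  proof (rule sum_mono)
    fix z assume "z \<in> ?N"
    then obtain a b where z: "z = (a, b)" "a \<in> lattice_net k" "b \<in> lattice_net l" by auto
    then show "measure_pmf.prob (bernoulli_matrix n) (B z) \<le> 2 * exp (- t\<^sup>2 / 2)"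
      unfolding z B_def prod.case using QC PC net_vec_norm
      by (intro bernoulli_bilinear_tail t)
         (auto simp: orthonormal_cols_vnorm[OF Q] orthonormal_cols_vnorm[OF P])
  qed
  also have "\<dots> = real (card (lattice_net k)) * real (card (lattice_net l)) * (2 * exp (- t\<^sup>2 / 2))"
    by (simp add: card_cartesian_product)
  also have "\<dots> \<le> exp (18 * real k) * exp (18 * real l) * (2 * exp (- t\<^sup>2 / 2))"
    by (intro mult_right_mono mult_mono card_lattice_net) auto
  also have "\<dots> = 2 * exp (18 * real (k + l) - t\<^sup>2 / 2)"
    by (simp add: algebra_simps flip: exp_add)
  finally show ?thesis .
qed

subsection \<open>Singular values of square matrices\<close>

lemma invertible_no_kernel:
  fixes H :: "real mat"
  assumes H: "H \<in> carrier_mat n n"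
    and ker: "\<And>x. x \<in> carrier_vec n \<Longrightarrow> H *\<^sub>v x = 0\<^sub>v n \<Longrightarrow> x = 0\<^sub>v n"
  obtains K where "K \<in> carrier_mat n n" "K * H = 1\<^sub>m n"
proof -
  have "Determinant.det H \<noteq> 0"
    using det_0_iff_vec_prod_zero[OF H] ker by auto
  from det_non_zero_imp_unit[OF H this] show ?thesis
    using that by (auto simp: Units_def ring_mat_def)
qed

text \<open>If the supremum \<open>\<mu>\<close> of the Rayleigh quotient were no eigenvalue, the positive semidefinite matrix
  \<open>\<mu> - G\<close> would be invertible and its quadratic form bounded away from 0 on the unit sphere.\<close>

lemma ex_max_eigenvalue:
  fixes G :: "real mat"
  assumes G: "G \<in> carrier_mat n n" and sym: "transpose_mat G = G" and n: "n > 0"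
  obtains \<mu> where "eigenvalue G \<mu>"
    "\<And>x. x \<in> carrier_vec n \<Longrightarrow> x \<bullet> (G *\<^sub>v x) \<le> \<mu> * (x \<bullet> x)"
proof -
  define S where "S = (\<lambda>x. x \<bullet> (G *\<^sub>v x)) ` {x. x \<in> carrier_vec n \<and> x \<bullet> x = 1}"
  define \<mu> where "\<mu> = Sup S"
  have "unit_vec n 0 \<in> {x :: real vec. x \<in> carrier_vec n \<and> x \<bullet> x = 1}"
    using n by simp
  then have ne: "S \<noteq> {}" unfolding S_def by blast
  obtain c where c: "\<And>x y. x \<in> carrier_vec n \<Longrightarrow> y \<in> carrier_vec n \<Longrightarrow>
       \<bar>x \<bullet> (G *\<^sub>v y)\<bar> \<le> c * vnorm x * vnorm y"
    using bilinear_bound_ex[OF G] by metis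
  have bdd: "bdd_above S"
  proof (rule bdd_aboveI)
    fix r assume "r \<in> S"
    then obtain x where x: "x \<in> carrier_vec n" "x \<bullet> x = 1" "r = x \<bullet> (G *\<^sub>v x)"
      by (auto simp: S_def)
    with c[of x x] show "r \<le> c" by (simp add: vnorm_def)
  qed
  have le: "x \<bullet> (G *\<^sub>v x) \<le> \<mu> * (x \<bullet> x)" if x: "x \<in> carrier_vec n" for x
  proof (cases "vnorm x = 0")
    case True
    then show ?thesis using c[OF x x] vnorm_square[of x] by simp
  next
    case False
    define y where "y = (1 / vnorm x) \<cdot>\<^sub>v x"
    have y: "y \<in> carrier_vec n" "y \<bullet> y = 1"
      using x False by (auto simp: y_def vnorm_square[symmetric] vnorm_smult)
    then have "y \<bullet> (G *\<^sub>v y) \<le> \<mu>"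
      unfolding \<mu>_def by (intro cSup_upper[OF _ bdd]) (auto simp: S_def)
    also have "y \<bullet> (G *\<^sub>v y) = (x \<bullet> (G *\<^sub>v x)) / (x \<bullet> x)"
      using x G by (simp add: y_def mult_mat_vec[OF G] vnorm_square[symmetric] power2_eq_square)
    finally show ?thesis
      using False by (simp add: pos_divide_le_eq less_le vnorm_square[symmetric])
  qed
  define H where "H = \<mu> \<cdot>\<^sub>m 1\<^sub>m n - G"
  have H: "H \<in> carrier_mat n n" using G by (simp add: H_def minus_carrier_mat)
  have scalar: "(\<mu> \<cdot>\<^sub>m 1\<^sub>m n) *\<^sub>v x = \<mu> \<cdot>\<^sub>v x" if "x \<in> carrier_vec n" for x
  proof (rule eq_vecI)
    fix i assume "i < dim_vec (\<mu> \<cdot>\<^sub>v x)"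
    then have i: "i < n" using that by simp
    then have "row (\<mu> \<cdot>\<^sub>m 1\<^sub>m n) i = \<mu> \<cdot>\<^sub>v unit_vec n i"
      by (intro eq_vecI) auto
    then show "((\<mu> \<cdot>\<^sub>m 1\<^sub>m n) *\<^sub>v x) $ i = (\<mu> \<cdot>\<^sub>v x) $ i"
      using that i by (simp add: scalar_prod_left_unit)
  qed (use that in auto)
  have Hx: "H *\<^sub>v x = \<mu> \<cdot>\<^sub>v x - G *\<^sub>v x" if "x \<in> carrier_vec n" for x
    using that G by (simp add: H_def minus_mult_distrib_mat_vec[of _ n n] scalar)
  have xHx: "x \<bullet> (H *\<^sub>v x) = \<mu> * (x \<bullet> x) - x \<bullet> (G *\<^sub>v x)" if "x \<in> carrier_vec n" for x
    using that G by (simp add: Hx scalar_prod_minus_distrib[of _ n])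
  have symH: "transpose_mat H = H"
  proof (rule eq_matI)
    fix i j assume "i < dim_row H" "j < dim_col H"
    moreover have "G $$ (i, j) = G $$ (j, i)" if "i < n" "j < n" for i j
      using sym G that by (metis carrier_matD index_transpose_mat(1))
    ultimately show "transpose_mat H $$ (i, j) = H $$ (i, j)"
      using G by (auto simp: H_def)
  qed (use H in auto)
  have psd: "0 \<le> x \<bullet> (H *\<^sub>v x)" if "x \<in> carrier_vec n" for x
    using le[OF that] xHx[OF that] by simp
  have "eigenvalue G \<mu>"
  proof (rule ccontr)
    assume not: "\<not> eigenvalue G \<mu>"
    have "x = 0\<^sub>v n" if x: "x \<in> carrier_vec n" "H *\<^sub>v x = 0\<^sub>v n" for x
    proof (rule ccontr)
      assume "x \<noteq> 0\<^sub>v n"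
      moreover have "G *\<^sub>v x = \<mu> \<cdot>\<^sub>v x"
      proof (rule eq_vecI)
        fix i assume "i < dim_vec (\<mu> \<cdot>\<^sub>v x)"
        then have i: "i < n" using x by simp
        have "(\<mu> \<cdot>\<^sub>v x - G *\<^sub>v x) $ i = 0" using x i by (simp add: Hx[symmetric])
        then show "(G *\<^sub>v x) $ i = (\<mu> \<cdot>\<^sub>v x) $ i" using x G i by simp
      qed (use x G in auto)
      ultimately show False
        using not x G by (auto simp: eigenvalue_def eigenvector_def)
    qed
    then obtain K where K: "K \<in> carrier_mat n n" "K * H = 1\<^sub>m n"
      using invertible_no_kernel[OF H] by metis
    obtain a where a: "a > 0" "\<And>y. y \<in> carrier_vec n \<Longrightarrow> vnorm (K *\<^sub>v y) \<le> a * vnorm y"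
      using bilinear_bound_ex[OF K(1)] by metis
    obtain b where b: "b > 0" "\<And>x y. x \<in> carrier_vec n \<Longrightarrow> y \<in> carrier_vec n \<Longrightarrow>
       \<bar>x \<bullet> (H *\<^sub>v y)\<bar> \<le> b * vnorm x * vnorm y"
      using bilinear_bound_ex[OF H] by metis
    have gap: "1 \<le> a\<^sup>2 * b * (x \<bullet> (H *\<^sub>v x))" if x: "x \<in> carrier_vec n" "x \<bullet> x = 1" for x
    proof -
      define h where "h = H *\<^sub>v x"
      have h: "h \<in> carrier_vec n" using H x by (simp add: h_def)
      have "K *\<^sub>v h = x"
        using K H x unfolding h_def by (metis assoc_mult_mat_vec one_mult_mat_vec)
      then have "1 \<le> a * vnorm h" using a(2)[OF h] x by (simp add: vnorm_def)
      then have one: "1 \<le> a\<^sup>2 * (vnorm h)\<^sup>2"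
        using power_mono[of 1 "a * vnorm h" 2] by (simp add: power_mult_distrib)
      then have pos: "(vnorm h)\<^sup>2 > 0" using a(1) by (cases "vnorm h = 0") auto
      have "((vnorm h)\<^sup>2)\<^sup>2 = (h \<bullet> (H *\<^sub>v x))\<^sup>2" by (simp add: vnorm_square h_def)
      also have "\<dots> \<le> h \<bullet> (H *\<^sub>v h) * (x \<bullet> (H *\<^sub>v x))"
        by (rule psd_Cauchy_Schwarz[OF H symH psd h x(1)])
      also have "\<dots> \<le> b * (vnorm h)\<^sup>2 * (x \<bullet> (H *\<^sub>v x))"
        using b(2)[OF h h] psd[OF x(1)]
        by (intro mult_right_mono) (auto simp: power2_eq_square mult.assoc)
      finally have "(vnorm h)\<^sup>2 * (vnorm h)\<^sup>2 \<le> (vnorm h)\<^sup>2 * (b * (x \<bullet> (H *\<^sub>v x)))"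
        by (simp add: power2_eq_square[of "(vnorm h)\<^sup>2"] mult_ac)
      then have "(vnorm h)\<^sup>2 \<le> b * (x \<bullet> (H *\<^sub>v x))"
        using pos by (simp only: mult_le_cancel_left_pos)
      then have "a\<^sup>2 * (vnorm h)\<^sup>2 \<le> a\<^sup>2 * (b * (x \<bullet> (H *\<^sub>v x)))"
        by (intro mult_left_mono) auto
      with one show ?thesis by (simp add: mult.assoc)
    qed
    have "\<mu> \<le> \<mu> - 1 / (a\<^sup>2 * b)"
      unfolding \<mu>_def
    proof (rule cSup_least[OF ne])
      fix r assume "r \<in> S"
      then obtain x where x: "x \<in> carrier_vec n" "x \<bullet> x = 1" "r = x \<bullet> (G *\<^sub>v x)"
        by (auto simp: S_def)
      have "1 / (a\<^sup>2 * b) \<le> x \<bullet> (H *\<^sub>v x)"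
        using gap[OF x(1,2)] a b by (simp add: pos_divide_le_eq mult.commute)
      then show "r \<le> Sup S - 1 / (a\<^sup>2 * b)"
        using xHx[OF x(1)] x by (simp add: \<mu>_def)
    qed
    moreover have "1 / (a\<^sup>2 * b) > 0" using a b by simp
    ultimately show False by simp
  qed
  then show ?thesis using that le by blast
qed

text \<open>The witness is the Householder reflection along \<open>v - unit_vec n 0\<close>.\<close>

lemma ex_reflection:
  fixes v :: "real vec"
  assumes v: "v \<in> carrier_vec n" and unit: "v \<bullet> v = 1" and n: "n > 0"
  obtains P where "P \<in> carrier_mat n n" "transpose_mat P = P" "P * P = 1\<^sub>m n"
    "P *\<^sub>v v = unit_vec n 0"
proof (cases "v = unit_vec n 0")
  case True
  then show ?thesis using that[of "1\<^sub>m n"] v by simp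
next
  case False
  define w where "w = v - unit_vec n 0"
  have w: "w \<in> carrier_vec n" using v by (simp add: w_def)
  have "w \<noteq> 0\<^sub>v n"
  proof
    assume "w = 0\<^sub>v n"
    then have "v $ i = unit_vec n 0 $ i" if "i < n" for i
      using that v by (metis w_def index_minus_vec(1) index_zero_vec(1) index_unit_vec(3) right_minus_eq)
    then show False using False v by (auto intro!: eq_vecI)
  qed
  then have "vnorm w \<noteq> 0" using w vnorm_eq_0_iff by blast
  then have ww: "w \<bullet> w \<noteq> 0" by (simp add: vnorm_def)
  define c where "c = 2 / (w \<bullet> w)"
  have c: "c * (w \<bullet> w) = 2" using ww by (simp add: c_def)
  define P where "P = Matrix.mat n n (\<lambda>(i, j). (if i = j then 1 else 0) - c * w $ i * w $ j)"
  have P: "P \<in> carrier_mat n n" by (simp add: P_def)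
  have Px: "P *\<^sub>v x = x - (c * (w \<bullet> x)) \<cdot>\<^sub>v w" if x: "x \<in> carrier_vec n" for x
  proof (rule eq_vecI)
    fix i assume "i < dim_vec (x - (c * (w \<bullet> x)) \<cdot>\<^sub>v w)"
    then have i: "i < n" using w by simp
    have "(P *\<^sub>v x) $ i = (\<Sum>j<n. ((if i = j then 1 else 0) - c * w $ i * w $ j) * x $ j)"
      using i x by (simp add: P_def scalar_prod_def atLeast0LessThan)
    also have "\<dots> = (\<Sum>j<n. (if i = j then x $ j else 0)) - c * w $ i * (\<Sum>j<n. w $ j * x $ j)"
      unfolding sum_distrib_left sum_subtractf[symmetric]
      by (intro sum.cong refl) (auto simp: algebra_simps)
    also have "\<dots> = (x - (c * (w \<bullet> x)) \<cdot>\<^sub>v w) $ i"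
      using i x w by (simp add: scalar_prod_def atLeast0LessThan)
    finally show "(P *\<^sub>v x) $ i = (x - (c * (w \<bullet> x)) \<cdot>\<^sub>v w) $ i" .
  qed (use w P in auto)
  have PP: "P *\<^sub>v (P *\<^sub>v x) = x" if x: "x \<in> carrier_vec n" for x
  proof (rule eq_vecI)
    define d where "d = c * (w \<bullet> x)"
    have Pxc: "P *\<^sub>v x \<in> carrier_vec n" using P x by simp
    have "c * (w \<bullet> (P *\<^sub>v x)) = c * (w \<bullet> x) - d * (c * (w \<bullet> w))"
      using w x by (simp add: Px d_def scalar_prod_minus_distrib[of _ n] algebra_simps)
    then have "c * (w \<bullet> (P *\<^sub>v x)) = - d" by (simp add: c d_def)
    then have "P *\<^sub>v (P *\<^sub>v x) = (x - d \<cdot>\<^sub>v w) - (- d) \<cdot>\<^sub>v w"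
      using Px[OF Pxc] Px[OF x] by (simp add: d_def)
    then show "(P *\<^sub>v (P *\<^sub>v x)) $ i = x $ i" if "i < dim_vec x" for i
      using that x w by simp
  qed (use P x in auto)
  have "P * P = 1\<^sub>m n"
  proof (rule eq_matI)
    fix i j assume "i < dim_row (1\<^sub>m n :: real mat)" "j < dim_col (1\<^sub>m n :: real mat)"
    then have ij: "i < n" "j < n" by auto
    have "(P * P) $$ (i, j) = ((P * P) *\<^sub>v unit_vec n j) $ i"
      using P ij by (simp del: assoc_mult_mat_vec add: scalar_prod_right_unit)
    also have "\<dots> = (P *\<^sub>v (P *\<^sub>v unit_vec n j)) $ i"
      using P by (simp add: assoc_mult_mat_vec[OF P P])
    also have "\<dots> = 1\<^sub>m n $$ (i, j)" using ij by (simp add: PP)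
    finally show "(P * P) $$ (i, j) = 1\<^sub>m n $$ (i, j)" .
  qed (use P in auto)
  moreover have "transpose_mat P = P"
    by (rule eq_matI) (auto simp: P_def)
  moreover have "P *\<^sub>v v = unit_vec n 0"
  proof -
    have "w \<bullet> v = 1 - v $ 0"
      using v n unit by (simp add: w_def minus_scalar_prod_distrib[of _ n] scalar_prod_left_unit)
    moreover have "w \<bullet> w = 2 * (1 - v $ 0)"
      using v n unit by (simp add: w_def minus_scalar_prod_distrib[of _ n]
          scalar_prod_minus_distrib[of _ n] scalar_prod_left_unit scalar_prod_right_unit)
    ultimately have "2 * (c * (w \<bullet> v)) = c * (w \<bullet> w)" by simp
    then have "c * (w \<bullet> v) = 1" using c by simp
    then have "P *\<^sub>v v = v - w" using Px[OF v] w by simp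
    also have "\<dots> = unit_vec n 0" using v by (auto simp: w_def intro!: eq_vecI)
    finally show ?thesis .
  qed
  ultimately show ?thesis using that P by blast
qed

lemma symmetric_deflation:
  fixes G :: "real mat"
  assumes G: "G \<in> carrier_mat (Suc m) (Suc m)" and sym: "transpose_mat G = G"
    and v: "v \<in> carrier_vec (Suc m)" "v \<bullet> v = 1" "G *\<^sub>v v = \<nu> \<cdot>\<^sub>v v"
  obtains G' where "G' \<in> carrier_mat m m" "transpose_mat G' = G'"
    "char_poly G = [:-\<nu>, 1:] * char_poly G'"
    "\<And>w. w \<in> carrier_vec (Suc m) \<Longrightarrow> w \<bullet> v = 0 \<Longrightarrow>
       \<exists>x\<in>carrier_vec m. w \<bullet> (G *\<^sub>v w) = x \<bullet> (G' *\<^sub>v x) \<and> w \<bullet> w = x \<bullet> x"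
proof -
  let ?n = "Suc m"
  obtain P where P: "P \<in> carrier_mat ?n ?n" "transpose_mat P = P" "P * P = 1\<^sub>m ?n"
      "P *\<^sub>v v = unit_vec ?n 0"
    using ex_reflection[OF v(1,2)] by blast
  have PP: "P *\<^sub>v (P *\<^sub>v x) = x" if "x \<in> carrier_vec ?n" for x
    using P that by (metis assoc_mult_mat_vec one_mult_mat_vec)
  have adj: "(P *\<^sub>v x) \<bullet> y = x \<bullet> (P *\<^sub>v y)" if "x \<in> carrier_vec ?n" "y \<in> carrier_vec ?n" for x y
    using scalar_prod_adjoint[OF P(1) that] P(2) by simp
  define B where "B = P * G * P"
  have B: "B \<in> carrier_mat ?n ?n" using P G by (simp add: B_def)
  have Bx: "B *\<^sub>v x = P *\<^sub>v (G *\<^sub>v (P *\<^sub>v x))" if "x \<in> carrier_vec ?n" for x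
    using P G that by (simp add: B_def assoc_mult_mat_vec[of _ ?n ?n _ ?n])
  have symB: "transpose_mat B = B"
    using P G sym by (simp add: B_def transpose_mult[of _ ?n ?n _ ?n] assoc_mult_mat[of _ ?n ?n _ ?n _ ?n])
  have "B *\<^sub>v unit_vec ?n 0 = \<nu> \<cdot>\<^sub>v unit_vec ?n 0"
    using Bx[of "unit_vec ?n 0"] PP[OF v(1)] P v mult_mat_vec[OF P(1) v(1)] by simp
  then have col0: "B $$ (i, 0) = (if i = 0 then \<nu> else 0)" if "i < ?n" for i
  proof -
    assume e: "B *\<^sub>v unit_vec ?n 0 = \<nu> \<cdot>\<^sub>v unit_vec ?n 0"
    have "(B *\<^sub>v unit_vec ?n 0) $ i = B $$ (i, 0)"
      using B that by (simp add: scalar_prod_right_unit)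
    then show ?thesis using that unfolding e by (simp split: if_splits)
  qed
  have row0: "B $$ (0, j) = (if j = 0 then \<nu> else 0)" if "j < ?n" for j
    using col0[OF that] B that symB by (metis carrier_matD index_transpose_mat(1) zero_less_Suc)
  define G' where "G' = Matrix.mat m m (\<lambda>(i, j). B $$ (Suc i, Suc j))"
  have G': "G' \<in> carrier_mat m m" by (simp add: G'_def)
  define L where "L = Matrix.mat 1 1 (\<lambda>_. \<nu>)"
  have L: "L \<in> carrier_mat 1 1" by (simp add: L_def)
  have block: "B = four_block_mat L (0\<^sub>m 1 m) (0\<^sub>m m 1) G'"
    by (rule eq_matI) (use B col0 row0 in \<open>auto simp: L_def G'_def\<close>)
  show ?thesis
  proof (rule that[OF G'])
    have "B $$ (i, j) = B $$ (j, i)" if "i < ?n" "j < ?n" for i j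
      using symB B that by (metis carrier_matD index_transpose_mat(1))
    then show "transpose_mat G' = G'" by (auto simp: G'_def)
    have "similar_mat B G"
      by (rule similar_matI[of _ _ P P ?n]) (use B G P in \<open>auto simp: B_def\<close>)
    then have "char_poly G = char_poly B" by (rule char_poly_similar[symmetric])
    also have "\<dots> = char_poly L * char_poly G'"
      unfolding block by (rule char_poly_four_block_zeros_col) (use L G' in auto)
    also have "char_poly L = [:-\<nu>, 1:]"
      by (subst char_poly_upper_triangular[OF L]) (auto simp: L_def diag_mat_def)
    finally show "char_poly G = [:-\<nu>, 1:] * char_poly G'" .
  next
    fix w assume w: "w \<in> carrier_vec ?n" "w \<bullet> v = 0"
    define z where "z = P *\<^sub>v w"
    define x where "x = vec_last z m"
    have z: "z \<in> carrier_vec (1 + m)" using P w by (simp add: z_def)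
    have x: "x \<in> carrier_vec m" by (simp add: x_def)
    have "z $ 0 = z \<bullet> unit_vec ?n 0"
      using z by (simp add: scalar_prod_right_unit)
    also have "\<dots> = w \<bullet> (P *\<^sub>v (P *\<^sub>v v))"
      using P v w by (simp add: z_def adj flip: P(4))
    also have "\<dots> = 0" using w PP[OF v(1)] by simp
    finally have "vec_first z 1 = 0\<^sub>v 1" by (auto simp: vec_first_def)
    then have zx: "z = 0\<^sub>v 1 @\<^sub>v x" using vec_first_last_append[OF z] by (simp add: x_def)
    have "B *\<^sub>v z = L *\<^sub>v 0\<^sub>v 1 @\<^sub>v G' *\<^sub>v x"
      unfolding block zx by (rule mult_mat_vec_split[OF L G']) (use x in auto)
    then have "z \<bullet> (B *\<^sub>v z) = x \<bullet> (G' *\<^sub>v x)"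
      unfolding zx using L G' x by (simp add: scalar_prod_append[of _ 1 _ m])
    moreover have "z \<bullet> (B *\<^sub>v z) = w \<bullet> (G *\<^sub>v w)"
      using P G w PP by (simp add: Bx z_def adj)
    moreover have "z \<bullet> z = x \<bullet> x"
      unfolding zx using x by (simp add: scalar_prod_append[of _ 1 _ m])
    moreover have "z \<bullet> z = w \<bullet> w"
      using P w PP by (simp add: z_def adj)
    ultimately show "\<exists>x\<in>carrier_vec m. w \<bullet> (G *\<^sub>v w) = x \<bullet> (G' *\<^sub>v x) \<and> w \<bullet> w = x \<bullet> x"
      using x by (intro bexI[of _ x]) auto
  qed
qed

lemma char_poly_nonzero: "G \<in> carrier_mat n n \<Longrightarrow> char_poly (G :: real mat) \<noteq> 0"
  using degree_monic_char_poly[of G n] by auto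

lemma set_proots_char_poly:
  fixes G :: "real mat"
  assumes "G \<in> carrier_mat n n"
  shows "set_mset (proots (char_poly G)) = {\<nu>. eigenvalue G \<nu>}"
  using eigenvalue_root_char_poly[OF assms] char_poly_nonzero[OF assms]
  by simp

lemma eigenvalue_le_max:
  fixes G :: "real mat"
  assumes G: "G \<in> carrier_mat n n" and ev: "eigenvalue G \<nu>"
    and le: "\<And>x. x \<in> carrier_vec n \<Longrightarrow> x \<bullet> (G *\<^sub>v x) \<le> \<mu> * (x \<bullet> x)"
  shows "\<nu> \<le> \<mu>"
proof -
  obtain x where x: "x \<in> carrier_vec n" "x \<noteq> 0\<^sub>v n" "G *\<^sub>v x = \<nu> \<cdot>\<^sub>v x"
    using ev G by (auto simp: eigenvalue_def eigenvector_def)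
  have "x \<bullet> x > 0"
    using x vnorm_eq_0_iff[of x n] by (simp add: less_le vnorm_def)
  moreover have "\<nu> * (x \<bullet> x) \<le> \<mu> * (x \<bullet> x)" using le[OF x(1)] x by simp
  ultimately show ?thesis by simp
qed

lemma last_sorted_eqI:
  fixes xs :: "'a :: linorder list"
  assumes "sorted xs" "x \<in> set xs" "\<And>y. y \<in> set xs \<Longrightarrow> y \<le> x"
  shows "last xs = x"
proof (rule order_antisym)
  have "xs \<noteq> []" using assms(2) by auto
  then show "last xs \<le> x" using assms(3) by simp
  obtain i where "i < length xs" "x = xs ! i" using assms(2) by (metis in_set_conv_nth)
  then show "x \<le> last xs"
    using sorted_nth_mono[OF assms(1), of i "length xs - 1"] \<open>xs \<noteq> []\<close> by (simp add: last_conv_nth)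
qed

lemma last_sorted_proots:
  fixes G :: "real mat"
  assumes G: "G \<in> carrier_mat n n" and sym: "transpose_mat G = G" and n: "n > 0"
  defines "xs \<equiv> sorted_list_of_multiset (proots (char_poly G))"
  shows "xs \<noteq> []" and "eigenvalue G (last xs)"
    and "x \<in> carrier_vec n \<Longrightarrow> x \<bullet> (G *\<^sub>v x) \<le> last xs * (x \<bullet> x)"
proof -
  obtain \<mu> where \<mu>: "eigenvalue G \<mu>"
      "\<And>x. x \<in> carrier_vec n \<Longrightarrow> x \<bullet> (G *\<^sub>v x) \<le> \<mu> * (x \<bullet> x)"
    using ex_max_eigenvalue[OF G sym n] by metis
  have set: "set xs = {\<nu>. eigenvalue G \<nu>}"
    using set_proots_char_poly[OF G] by (simp add: xs_def)
  then show "xs \<noteq> []" using \<mu>(1) by auto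
  have "last xs = \<mu>"
    by (rule last_sorted_eqI) (use set \<mu> eigenvalue_le_max[OF G] in \<open>auto simp: xs_def\<close>)
  then show "eigenvalue G (last xs)"
    "x \<in> carrier_vec n \<Longrightarrow> x \<bullet> (G *\<^sub>v x) \<le> last xs * (x \<bullet> x)"
    using \<mu> by auto
qed

lemma gram_carrier: "M \<in> carrier_mat n n \<Longrightarrow> transpose_mat M * M \<in> carrier_mat n n"
  by simp

lemma gram_symmetric:
  "M \<in> carrier_mat n n \<Longrightarrow> transpose_mat (transpose_mat M * M) = transpose_mat M * (M :: real mat)"
  by (subst transpose_mult[of _ n n _ n]) auto

lemma gram_scalar_prod:
  fixes M :: "real mat"
  assumes M: "M \<in> carrier_mat n n" and x: "x \<in> carrier_vec n"
  shows "x \<bullet> ((transpose_mat M * M) *\<^sub>v x) = (vnorm (M *\<^sub>v x))\<^sup>2"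
proof -
  have "x \<bullet> ((transpose_mat M * M) *\<^sub>v x) = x \<bullet> (transpose_mat M *\<^sub>v (M *\<^sub>v x))"
    using M x by (subst assoc_mult_mat_vec[of _ n n _ n]) auto
  also have "\<dots> = (M *\<^sub>v x) \<bullet> (M *\<^sub>v x)"
    using M x by (subst scalar_prod_adjoint[of _ n n]) auto
  finally show ?thesis by (simp add: vnorm_square)
qed

lemma gram_eigenvalue_nonneg:
  fixes M :: "real mat"
  assumes M: "M \<in> carrier_mat n n" and ev: "eigenvalue (transpose_mat M * M) \<nu>"
  shows "0 \<le> \<nu>"
proof -
  obtain x where x: "x \<in> carrier_vec n" "x \<noteq> 0\<^sub>v n" "(transpose_mat M * M) *\<^sub>v x = \<nu> \<cdot>\<^sub>v x"
    using ev M by (auto simp: eigenvalue_def eigenvector_def)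
  have "x \<bullet> x > 0"
    using x vnorm_eq_0_iff[of x n] by (simp add: less_le vnorm_def)
  moreover have "\<nu> * (x \<bullet> x) = (vnorm (M *\<^sub>v x))\<^sup>2"
    using gram_scalar_prod[OF M x(1)] x by simp
  ultimately show ?thesis by (metis zero_le_power2 zero_le_mult_iff not_le)
qed

lemma vnorm_le_of_gram:
  assumes "(vnorm y)\<^sup>2 \<le> c * (x \<bullet> x)" "0 \<le> c"
  shows "vnorm y \<le> sqrt c * vnorm x"
  using real_sqrt_le_mono[OF assms(1)] assms(2) by (simp add: vnorm_def real_sqrt_mult)

lemma singular_value_1:
  assumes M: "M \<in> carrier_mat n n" and n: "n > 0"
  shows "0 \<le> singular_value M 1"
    and "x \<in> carrier_vec n \<Longrightarrow> vnorm (M *\<^sub>v x) \<le> singular_value M 1 * vnorm x"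
proof -
  let ?G = "transpose_mat M * M"
  define xs where "xs = sorted_list_of_multiset (proots (char_poly ?G))"
  note G = gram_carrier[OF M] and sym = gram_symmetric[OF M]
  note top = last_sorted_proots[OF G sym n, folded xs_def]
  have eq: "singular_value M 1 = sqrt (last xs)"
    using top(1) by (simp add: singular_value_def singular_values_def xs_def[symmetric]
        rev_map[symmetric] hd_conv_nth[symmetric] hd_rev last_map)
  have nonneg: "0 \<le> last xs" by (rule gram_eigenvalue_nonneg[OF M top(2)])
  then show "0 \<le> singular_value M 1" unfolding eq by simp
  show "vnorm (M *\<^sub>v x) \<le> singular_value M 1 * vnorm x" if x: "x \<in> carrier_vec n"
    using top(3)[OF x] nonneg unfolding eq gram_scalar_prod[OF M x] by (rule vnorm_le_of_gram)
qed

lemma singular_value_2: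
  assumes M: "M \<in> carrier_mat n n" and n: "n \<ge> 2" and v: "first_unit_singular_vector M v"
  shows "0 \<le> singular_value M 2" and "singular_value M 2 \<le> singular_value M 1"
    and "w \<in> carrier_vec n \<Longrightarrow> w \<bullet> v = 0 \<Longrightarrow> vnorm (M *\<^sub>v w) \<le> singular_value M 2 * vnorm w"
proof -
  let ?G = "transpose_mat M * M"
  define \<nu> where "\<nu> = (singular_value M 1)\<^sup>2"
  obtain m where m: "n = Suc m" "m > 0" using n by (cases n) auto
  note G = gram_carrier[OF M] and sym = gram_symmetric[OF M]
  have v': "v \<in> carrier_vec n" "v \<bullet> v = 1" "?G *\<^sub>v v = \<nu> \<cdot>\<^sub>v v"
    using v M by (auto simp: first_unit_singular_vector_def eigenvector_def \<nu>_def)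
  obtain G' where G': "G' \<in> carrier_mat m m" "transpose_mat G' = G'"
      "char_poly ?G = [:-\<nu>, 1:] * char_poly G'"
    and red: "\<And>w. w \<in> carrier_vec n \<Longrightarrow> w \<bullet> v = 0 \<Longrightarrow>
       \<exists>x\<in>carrier_vec m. w \<bullet> (?G *\<^sub>v w) = x \<bullet> (G' *\<^sub>v x) \<and> w \<bullet> w = x \<bullet> x"
    using symmetric_deflation[OF G[unfolded m(1)] sym v'[unfolded m(1)]] m(1) by metis
  define ys where "ys = sorted_list_of_multiset (proots (char_poly G'))"
  note top = last_sorted_proots[OF G'(1,2) m(2), folded ys_def]
  have roots: "proots (char_poly ?G) = add_mset \<nu> (proots (char_poly G'))"
    using char_poly_nonzero[OF G'(1)] unfolding G'(3) by (subst proots_mult) auto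
  have ev: "eigenvalue ?G y" if "y \<in> set ys" for y
  proof -
    have "y \<in># proots (char_poly ?G)" using that by (simp add: roots ys_def)
    then show ?thesis using set_proots_char_poly[OF G] by auto
  qed
  have max: "y \<le> \<nu>" if "y \<in> set ys" for y
  proof (rule eigenvalue_le_max[OF G ev[OF that]])
    fix x :: "real vec" assume x: "x \<in> carrier_vec n"
    have "(vnorm (M *\<^sub>v x))\<^sup>2 \<le> (singular_value M 1 * vnorm x)\<^sup>2"
      using singular_value_1[OF M] n x by (intro power_mono) auto
    then show "x \<bullet> (?G *\<^sub>v x) \<le> \<nu> * (x \<bullet> x)"
      by (simp add: gram_scalar_prod[OF M x] \<nu>_def power_mult_distrib vnorm_square)
  qed
  have "sorted_list_of_multiset (proots (char_poly ?G)) = ys @ [\<nu>]"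
    unfolding roots using max by (simp add: ys_def sorted_insort_is_snoc)
  then have eq: "singular_value M 2 = sqrt (last ys)"
    using top(1) by (simp add: singular_value_def singular_values_def
        rev_map[symmetric] hd_conv_nth[symmetric] hd_rev last_map)
  have last: "last ys \<in> set ys" using top(1) by simp
  have nonneg: "0 \<le> last ys" by (rule gram_eigenvalue_nonneg[OF M ev[OF last]])
  then show "0 \<le> singular_value M 2" by (simp add: eq)
  have "sqrt (last ys) \<le> sqrt \<nu>" using max[OF last] by simp
  then show "singular_value M 2 \<le> singular_value M 1"
    using singular_value_1(1)[OF M] n by (simp add: eq \<nu>_def)
  assume w: "w \<in> carrier_vec n" "w \<bullet> v = 0"
  obtain x where x: "x \<in> carrier_vec m" "w \<bullet> (?G *\<^sub>v w) = x \<bullet> (G' *\<^sub>v x)" "w \<bullet> w = x \<bullet> x"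
    using red[OF w] by blast
  have "(vnorm (M *\<^sub>v w))\<^sup>2 \<le> last ys * (w \<bullet> w)"
    using top(3)[OF x(1)] x gram_scalar_prod[OF M w(1)] by simp
  then show "vnorm (M *\<^sub>v w) \<le> singular_value M 2 * vnorm w"
    unfolding eq using nonneg by (rule vnorm_le_of_gram)
qed

subsection \<open>Column and row space\<close>

lemma orthonormal_cols_proj:
  assumes Q: "orthonormal_cols n k Q" and x: "x \<in> carrier_vec n"
  shows "transpose_mat Q *\<^sub>v (x - Q *\<^sub>v (transpose_mat Q *\<^sub>v x)) = 0\<^sub>v k"
proof -
  have C: "Q \<in> carrier_mat n k" "transpose_mat Q * Q = 1\<^sub>m k"
    using Q by (auto simp: orthonormal_cols_def)
  have Qt: "transpose_mat Q \<in> carrier_mat k n" using C by simp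
  define z where "z = transpose_mat Q *\<^sub>v x"
  have z: "z \<in> carrier_vec k" using Qt x by (simp add: z_def)
  have "transpose_mat Q *\<^sub>v (x - Q *\<^sub>v z) = z - transpose_mat Q *\<^sub>v (Q *\<^sub>v z)"
    using C Qt x z by (subst mult_minus_distrib_mat_vec[OF Qt]) (auto simp: z_def)
  also have "transpose_mat Q *\<^sub>v (Q *\<^sub>v z) = (transpose_mat Q * Q) *\<^sub>v z"
    by (rule assoc_mult_mat_vec[OF Qt C(1) z, symmetric])
  also have "\<dots> = z" using C z by simp
  also have "z - z = 0\<^sub>v k" using z by simp
  finally show ?thesis by (simp add: z_def)
qed

text \<open>The span of the columns is described as a double orthogonal complement.\<close>

lemma orthonormal_cols_fixed:
  assumes Q: "orthonormal_cols n k Q" and x: "x \<in> carrier_vec n"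
    and perp: "\<And>w. w \<in> carrier_vec n \<Longrightarrow> transpose_mat Q *\<^sub>v w = 0\<^sub>v k \<Longrightarrow> x \<bullet> w = 0"
  shows "Q *\<^sub>v (transpose_mat Q *\<^sub>v x) = x"
proof -
  note C = orthonormal_cols_carrier[OF Q]
  define z where "z = transpose_mat Q *\<^sub>v x"
  define w where "w = x - Q *\<^sub>v z"
  have z: "z \<in> carrier_vec k" using C x by (simp add: z_def)
  have w: "w \<in> carrier_vec n" using C x z by (simp add: w_def)
  have Qw: "transpose_mat Q *\<^sub>v w = 0\<^sub>v k"
    using orthonormal_cols_proj[OF Q x] by (simp add: w_def z_def)
  have "w \<bullet> (Q *\<^sub>v z) = 0"
    using Qw z by (simp add: scalar_prod_adjoint[OF C w z])
  moreover have "w \<bullet> x = 0"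
    using perp[OF w Qw] comm_scalar_prod[OF w x] by simp
  moreover have "w \<bullet> w = w \<bullet> x - w \<bullet> (Q *\<^sub>v z)"
    using scalar_prod_minus_distrib[of w n x "Q *\<^sub>v z"] C w x z by (simp add: w_def)
  ultimately have "w = 0\<^sub>v n"
    using vnorm_eq_0_iff[OF w] by (simp add: vnorm_def)
  then have "(x - Q *\<^sub>v z) $ i = 0" if "i < n" for i
    using that by (simp add: w_def)
  then show ?thesis
    using C x unfolding z_def by (intro eq_vecI) (auto simp del: index_mult_mat_vec)
qed

lemma gram_schmidt_ex:
  assumes "set xs \<subseteq> carrier_vec n"
  shows "\<exists>k\<le>length xs. \<exists>Q. orthonormal_cols n k Q \<and>
    (\<forall>x\<in>set xs. \<forall>w\<in>carrier_vec n. transpose_mat Q *\<^sub>v w = 0\<^sub>v k \<longrightarrow> x \<bullet> w = 0)"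
  using assms
proof (induction xs)
  case Nil
  have "orthonormal_cols n 0 (0\<^sub>m n 0)"
    by (auto simp: orthonormal_cols_def)
  then show ?case by auto
next
  case (Cons x xs)
  then obtain k Q where k: "k \<le> length xs" and Q: "orthonormal_cols n k Q"
    and perp: "\<And>y w. y \<in> set xs \<Longrightarrow> w \<in> carrier_vec n \<Longrightarrow> transpose_mat Q *\<^sub>v w = 0\<^sub>v k \<Longrightarrow> y \<bullet> w = 0"
    by auto
  have x: "x \<in> carrier_vec n" using Cons by simp
  note C = orthonormal_cols_carrier[OF Q]
  define z where "z = transpose_mat Q *\<^sub>v x"
  define y where "y = x - Q *\<^sub>v z"
  have z: "z \<in> carrier_vec k" using C x by (simp add: z_def)
  have y: "y \<in> carrier_vec n" using C x z by (simp add: y_def)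
  have Qy: "transpose_mat Q *\<^sub>v y = 0\<^sub>v k"
    using orthonormal_cols_proj[OF Q x] by (simp add: y_def z_def)
  have xw: "x \<bullet> w = y \<bullet> w" if w: "w \<in> carrier_vec n" "transpose_mat Q *\<^sub>v w = 0\<^sub>v k" for w
  proof -
    have "w \<bullet> (Q *\<^sub>v z) = 0" using scalar_prod_adjoint[OF C w(1) z] w z by simp
    then have "(Q *\<^sub>v z) \<bullet> w = 0" using C z w by (simp add: comm_scalar_prod[of _ n])
    then show ?thesis
      using C x z w by (simp add: y_def minus_scalar_prod_distrib[of _ n])
  qed
  show ?case
  proof (cases "vnorm y = 0")
    case True
    then have "y = 0\<^sub>v n" using vnorm_eq_0_iff[OF y] by simp
    then have "x \<bullet> w = 0" if "w \<in> carrier_vec n" "transpose_mat Q *\<^sub>v w = 0\<^sub>v k" for w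
      using xw[OF that] that by simp
    then show ?thesis using k Q perp
      by (intro exI[of _ k] conjI exI[of _ Q]) auto
  next
    case False
    define q where "q = (1 / vnorm y) \<cdot>\<^sub>v y"
    have q: "q \<in> carrier_vec n" "q \<bullet> q = 1"
      using y False by (auto simp: q_def vnorm_square[symmetric] vnorm_smult)
    have Qq: "col Q i \<bullet> q = 0" if "i < k" for i
    proof -
      have "(transpose_mat Q *\<^sub>v y) $ i = 0" using Qy that by simp
      then show ?thesis using C that y by (simp add: q_def)
    qed
    define Q' where "Q' = Matrix.mat n (Suc k) (\<lambda>(i, j). if j < k then Q $$ (i, j) else q $ i)"
    have Q': "Q' \<in> carrier_mat n (Suc k)" by (simp add: Q'_def)
    have col: "col Q' j = (if j < k then col Q j else q)" if "j < Suc k" for j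
      using that C q by (intro eq_vecI) (auto simp: Q'_def)
    have Qc: "col Q i \<bullet> col Q j = (if i = j then 1 else 0)" if "i < k" "j < k" for i j
    proof -
      have "(transpose_mat Q * Q) $$ (i, j) = col Q i \<bullet> col Q j" using C that by simp
      then show ?thesis using Q that by (simp add: orthonormal_cols_def)
    qed
    have "orthonormal_cols n (Suc k) Q'"
      unfolding orthonormal_cols_def
    proof (intro conjI Q' eq_matI)
      fix i j assume "i < dim_row (1\<^sub>m (Suc k) :: real mat)" "j < dim_col (1\<^sub>m (Suc k) :: real mat)"
      then have ij: "i < Suc k" "j < Suc k" by auto
      have "(transpose_mat Q' * Q') $$ (i, j) = col Q' i \<bullet> col Q' j"
        using Q' ij by simp
      also have "\<dots> = (if i = j then 1 else 0)"
        using ij C q Qc Qq comm_scalar_prod[of q n "col Q j"] by (auto simp: col less_Suc_eq)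
      finally show "(transpose_mat Q' * Q') $$ (i, j) = 1\<^sub>m (Suc k) $$ (i, j)"
        using ij by simp
    qed (use Q' in auto)
    moreover have "u \<bullet> w = 0"
      if u: "u \<in> set (x # xs)" and w: "w \<in> carrier_vec n" "transpose_mat Q' *\<^sub>v w = 0\<^sub>v (Suc k)" for u w
    proof -
      have c: "col Q' i \<bullet> w = 0" if "i < Suc k" for i
      proof -
        have "(transpose_mat Q' *\<^sub>v w) $ i = 0" using w that by simp
        then show ?thesis using Q' that by simp
      qed
      have Qw: "transpose_mat Q *\<^sub>v w = 0\<^sub>v k"
      proof (rule eq_vecI)
        fix i assume "i < dim_vec (0\<^sub>v k :: real vec)"
        then show "(transpose_mat Q *\<^sub>v w) $ i = 0\<^sub>v k $ i"
          using c[of i] col[of i] C by simp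
      qed (use C in simp)
      have "q \<bullet> w = 0" using c[of k] col[of k] by simp
      then have "y \<bullet> w = 0" using y w False by (simp add: q_def)
      then show ?thesis using u perp[OF _ w(1) Qw] xw[OF w(1) Qw] by auto
    qed
    ultimately show ?thesis using k
      by (intro exI[of _ "Suc k"] conjI exI[of _ Q']) auto
  qed
qed

lemma orthonormal_cols_fixed_mat:
  fixes B :: "real mat"
  assumes Q: "orthonormal_cols n l Q" and B: "B \<in> carrier_mat n k"
    and fixed: "\<And>x. x \<in> set (cols B) \<Longrightarrow> Q *\<^sub>v (transpose_mat Q *\<^sub>v x) = x"
  shows "Q * (transpose_mat Q * B) = B"
proof (rule eq_matI)
  note C = orthonormal_cols_carrier[OF Q]
  fix i j assume "i < dim_row B" "j < dim_col B"
  then have ij: "i < n" "j < k" using B by auto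
  then have "col B j \<in> set (cols B)" using B by (simp add: cols_def)
  then have "(Q *\<^sub>v (transpose_mat Q *\<^sub>v col B j)) $ i = B $$ (i, j)"
    using fixed ij B by simp
  moreover have "transpose_mat Q *\<^sub>v col B j = col (transpose_mat Q * B) j"
    using C B ij by (intro eq_vecI) auto
  ultimately show "(Q * (transpose_mat Q * B)) $$ (i, j) = B $$ (i, j)"
    using C B ij by simp
qed (use orthonormal_cols_carrier[OF Q] B in auto)

lemma (in vec_space) rank_spanning_set:
  assumes A: "A \<in> carrier_mat n nc"
  shows "\<exists>S. finite S \<and> S \<subseteq> carrier_vec n \<and> card S = rank A \<and> set (cols A) \<subseteq> span S"
proof -
  obtain S where S: "maximal S (\<lambda>T. T \<subseteq> set (cols A) \<and> lin_indpt T)"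
    using maximal_exists[of "(\<lambda>T. T \<subseteq> set (cols A) \<and> lin_indpt T)" "card (set (cols A))" "{}"]
    by (meson List.finite_set card_mono empty_iff empty_subsetI finite_lin_indpt2 finite.emptyI rev_finite_subset)
  have cols: "set (cols A) \<subseteq> carrier_vec n" using A cols_dim by blast
  have sub: "S \<subseteq> set (cols A)" "lin_indpt S" using S by (auto simp: maximal_def)
  have fin: "finite S" using sub finite_subset by blast
  have "c \<in> span S" if c: "c \<in> set (cols A)" for c
  proof (cases "c \<in> S")
    case True
    then show ?thesis using span_mem sub cols by (meson subset_trans)
  next
    case False
    then have "\<not> lin_indpt (insert c S)"
      using S c sub unfolding maximal_def by (metis insertI1 insert_subset subset_insertI)
    then show ?thesis
      using lin_dep_iff_in_span[of S c] sub cols c False by auto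
  qed
  moreover have "S \<subseteq> carrier_vec n" using sub(1) cols by (rule subset_trans)
  ultimately show ?thesis using fin rank_card_indpt[OF A S] by (intro exI[of _ S]) auto
qed

lemma (in vec_space) span_perp:
  assumes S: "S \<subseteq> carrier_vec n" and w: "w \<in> carrier_vec n"
    and perp: "\<And>x. x \<in> S \<Longrightarrow> x \<bullet> w = 0" and c: "c \<in> span S"
  shows "c \<bullet> w = 0"
proof -
  let ?N = "{x \<in> carrier_vec n. x \<bullet> w = 0}"
  have "submodule class_ring ?N V"
    unfolding submodule_def using w module_axioms
    by (auto simp: add_scalar_prod_distrib[of _ n] class_ring_simps module_vec_def)
  then have "span S \<subseteq> ?N"
    by (rule span_is_subset[rotated]) (use S perp in auto)
  then show ?thesis using c by auto
qed

lemma ex_singular_subspaces: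
  fixes A :: "real mat"
  assumes A: "A \<in> carrier_mat n n"
  obtains k l Q P where "k \<le> vec_space.rank n A" "l \<le> vec_space.rank n A"
    "orthonormal_cols n k Q" "orthonormal_cols n l P"
    "Q * (transpose_mat Q * A) = A" "P * (transpose_mat P * transpose_mat A) = transpose_mat A"
proof -
  interpret vec_space "TYPE(real)" n .
  obtain S where S: "finite S" "S \<subseteq> carrier_vec n" "card S = rank A" "set (cols A) \<subseteq> span S"
    using rank_spanning_set[OF A] by blast
  obtain xs where xs: "set xs = S" "distinct xs" using finite_distinct_list[OF S(1)] by blast
  then have len: "length xs = rank A" using S(3) distinct_card by metis
  have "set xs \<subseteq> carrier_vec n" using xs S by simp
  from gram_schmidt_ex[OF this] obtain k Q where k: "k \<le> rank A" and Q: "orthonormal_cols n k Q"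
    and perp: "\<And>x w. x \<in> S \<Longrightarrow> w \<in> carrier_vec n \<Longrightarrow> transpose_mat Q *\<^sub>v w = 0\<^sub>v k \<Longrightarrow> x \<bullet> w = 0"
    using xs len by auto
  note C = orthonormal_cols_carrier[OF Q]
  have QA: "Q * (transpose_mat Q * A) = A"
  proof (rule orthonormal_cols_fixed_mat[OF Q A])
    fix c assume "c \<in> set (cols A)"
    then have c: "c \<in> span S" "c \<in> carrier_vec n" using S A cols_dim by blast+
    show "Q *\<^sub>v (transpose_mat Q *\<^sub>v c) = c"
      by (rule orthonormal_cols_fixed[OF Q c(2)], rule span_perp[OF S(2) _ _ c(1)], assumption,
          rule perp)
  qed
  define B where "B = transpose_mat A * Q"
  have B: "B \<in> carrier_mat n k" using A C by (simp add: B_def)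
  have "set (cols B) \<subseteq> carrier_vec n" using B cols_dim by blast
  from gram_schmidt_ex[OF this] obtain l P where l: "l \<le> k" and P: "orthonormal_cols n l P"
    and perp': "\<And>x w. x \<in> set (cols B) \<Longrightarrow> w \<in> carrier_vec n \<Longrightarrow> transpose_mat P *\<^sub>v w = 0\<^sub>v l \<Longrightarrow> x \<bullet> w = 0"
    using B by auto
  note D = orthonormal_cols_carrier[OF P]
  have "P * (transpose_mat P * B) = B"
  proof (rule orthonormal_cols_fixed_mat[OF P B])
    fix c assume c: "c \<in> set (cols B)"
    then have "c \<in> carrier_vec n" using B cols_dim by blast
    then show "P *\<^sub>v (transpose_mat P *\<^sub>v c) = c"
      by (rule orthonormal_cols_fixed[OF P]) (rule perp'[OF c])
  qed
  moreover have "transpose_mat A = B * transpose_mat Q"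
  proof -
    have "transpose_mat A = transpose_mat (Q * (transpose_mat Q * A))" by (simp add: QA)
    also have "\<dots> = transpose_mat (transpose_mat Q * A) * transpose_mat Q"
      using A C by (intro transpose_mult) auto
    also have "transpose_mat (transpose_mat Q * A) = B"
      using A C transpose_mult[of "transpose_mat Q" k n A n] by (simp add: B_def)
    finally show ?thesis .
  qed
  moreover have "transpose_mat P * (B * transpose_mat Q) = transpose_mat P * B * transpose_mat Q"
    by (rule assoc_mult_mat[symmetric, of _ l n _ k _ n]) (use B C D in auto)
  moreover have "P * (transpose_mat P * B * transpose_mat Q) = P * (transpose_mat P * B) * transpose_mat Q"
    by (rule assoc_mult_mat[symmetric, of _ n l _ k _ n]) (use B C D in auto)
  ultimately have PA: "P * (transpose_mat P * transpose_mat A) = transpose_mat A"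
    by simp
  show ?thesis
    by (rule that[OF k order_trans[OF l k] Q P QA PA])
qed

subsection \<open>Perturbation of the first singular vector\<close>

lemma orthonormal_cols_transpose_contraction:
  assumes Q: "orthonormal_cols n k Q" and y: "y \<in> carrier_vec n"
  shows "vnorm (transpose_mat Q *\<^sub>v y) \<le> vnorm y"
proof (cases "vnorm (transpose_mat Q *\<^sub>v y) = 0")
  case False
  note C = orthonormal_cols_carrier[OF Q]
  define z where "z = transpose_mat Q *\<^sub>v y"
  have z: "z \<in> carrier_vec k" using C y by (simp add: z_def)
  have "(vnorm z)\<^sup>2 = y \<bullet> (Q *\<^sub>v z)"
    using scalar_prod_adjoint[OF C y z] by (simp add: vnorm_square z_def)
  also have "\<dots> \<le> vnorm y * vnorm z"
    using vec_Cauchy_Schwarz[of y n "Q *\<^sub>v z"] C y z orthonormal_cols_vnorm[OF Q z] by auto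
  finally have "vnorm z * vnorm z \<le> vnorm y * vnorm z" by (simp add: power2_eq_square)
  moreover have "0 < vnorm z" using False by (simp add: z_def less_le)
  ultimately show ?thesis by (simp add: z_def)
qed simp

lemma orthonormal_cols_range:
  assumes Q: "orthonormal_cols n k Q" and A: "A \<in> carrier_mat n n"
    and QA: "Q * (transpose_mat Q * A) = A" and x: "x \<in> carrier_vec n"
  shows "Q *\<^sub>v (transpose_mat Q *\<^sub>v (A *\<^sub>v x)) = A *\<^sub>v x"
proof -
  note C = orthonormal_cols_carrier[OF Q]
  have "Q *\<^sub>v (transpose_mat Q *\<^sub>v (A *\<^sub>v x)) = (Q * (transpose_mat Q * A)) *\<^sub>v x"
    using C A x by (simp add: assoc_mult_mat_vec[of _ n k _ n] assoc_mult_mat_vec[of _ k n _ n])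
  then show ?thesis by (simp add: QA)
qed

text \<open>A left singular vector \<open>y\<close> of \<open>A + E\<close> is close to the column space of \<open>A\<close>, because \<open>A\<close> contributes
  nothing to the component of \<open>(A + E) x\<close> orthogonal to it.\<close>

lemma residual_bound:
  fixes A E :: "real mat"
  assumes A: "A \<in> carrier_mat n n" and E: "E \<in> carrier_mat n n"
    and Q: "orthonormal_cols n k Q" and QA: "Q * (transpose_mat Q * A) = A"
    and x: "x \<in> carrier_vec n" "vnorm x = 1" and y: "y \<in> carrier_vec n"
    and xy: "(A + E) *\<^sub>v x = s \<cdot>\<^sub>v y" and s: "s > 0"
    and L: "\<And>x y. x \<in> carrier_vec n \<Longrightarrow> y \<in> carrier_vec n \<Longrightarrow> \<bar>x \<bullet> (E *\<^sub>v y)\<bar> \<le> L * vnorm x * vnorm y"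
    and L0: "L \<ge> 0"
  shows "vnorm (y - Q *\<^sub>v (transpose_mat Q *\<^sub>v y)) \<le> L / s"
proof -
  note C = orthonormal_cols_carrier[OF Q]
  define z where "z = y - Q *\<^sub>v (transpose_mat Q *\<^sub>v y)"
  have z: "z \<in> carrier_vec n" using C y by (simp add: z_def)
  have Qz: "transpose_mat Q *\<^sub>v z = 0\<^sub>v k"
    using orthonormal_cols_proj[OF Q y] by (simp add: z_def)
  have perp: "z \<bullet> (Q *\<^sub>v b) = 0" if "b \<in> carrier_vec k" for b
    using scalar_prod_adjoint[OF C z that] Qz that by simp
  have zy: "z \<bullet> y = z \<bullet> z"
    using scalar_prod_minus_distrib[of z n y "Q *\<^sub>v (transpose_mat Q *\<^sub>v y)"]
      perp[of "transpose_mat Q *\<^sub>v y"] C y z by (simp add: z_def)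
  have zA: "z \<bullet> (A *\<^sub>v x) = 0"
    using perp[of "transpose_mat Q *\<^sub>v (A *\<^sub>v x)"] orthonormal_cols_range[OF Q A QA x(1)] C A x by simp
  have "s * (vnorm z)\<^sup>2 = z \<bullet> ((A + E) *\<^sub>v x)"
    using zy y z by (simp add: xy vnorm_square)
  also have "\<dots> = z \<bullet> (E *\<^sub>v x)"
    using A E x z zA by (simp add: add_mult_distrib_mat_vec[of _ n n] scalar_prod_add_distrib[of _ n])
  also have "\<dots> \<le> L * vnorm z" using L[OF z x(1)] x by auto
  finally have *: "(s * vnorm z) * vnorm z \<le> L * vnorm z" by (simp add: power2_eq_square mult.assoc)
  show ?thesis
  proof (cases "vnorm z = 0")
    case True
    then show ?thesis using L0 s by (simp add: z_def)
  next
    case False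
    then have "0 < vnorm z" by (simp add: less_le)
    with * have "s * vnorm z \<le> L" by (simp only: mult_le_cancel_right_pos)
    then show ?thesis using s by (simp add: z_def pos_le_divide_eq mult.commute)
  qed
qed

lemma first_unit_singular_vectorD:
  assumes M: "M \<in> carrier_mat n n" and v: "first_unit_singular_vector M v"
    and pos: "singular_value M 1 > 0"
  obtains u where "v \<in> carrier_vec n" "vnorm v = 1" "u \<in> carrier_vec n" "vnorm u = 1"
    "M *\<^sub>v v = singular_value M 1 \<cdot>\<^sub>v u" "transpose_mat M *\<^sub>v u = singular_value M 1 \<cdot>\<^sub>v v"
proof -
  define s where "s = singular_value M 1"
  have v': "v \<in> carrier_vec n" "v \<bullet> v = 1" "(transpose_mat M * M) *\<^sub>v v = s\<^sup>2 \<cdot>\<^sub>v v"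
    using v M by (auto simp: first_unit_singular_vector_def eigenvector_def s_def)
  define u where "u = (1 / s) \<cdot>\<^sub>v (M *\<^sub>v v)"
  have u: "u \<in> carrier_vec n" using M v' by (simp add: u_def)
  have "(vnorm (M *\<^sub>v v))\<^sup>2 = s\<^sup>2"
    using gram_scalar_prod[OF M v'(1)] v' by simp
  then have "vnorm (M *\<^sub>v v) = s" using pos by (simp add: s_def power2_eq_iff_nonneg)
  then have "vnorm u = 1" using pos by (simp add: u_def vnorm_smult s_def)
  moreover have "M *\<^sub>v v = s \<cdot>\<^sub>v u"
    using pos M v' by (simp add: u_def smult_smult_assoc s_def)
  moreover have "transpose_mat M *\<^sub>v u = s \<cdot>\<^sub>v v"
  proof -
    have "transpose_mat M *\<^sub>v u = (1 / s) \<cdot>\<^sub>v (transpose_mat M *\<^sub>v (M *\<^sub>v v))"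
      unfolding u_def using M v' by (intro mult_mat_vec[of _ n n]) auto
    also have "transpose_mat M *\<^sub>v (M *\<^sub>v v) = s\<^sup>2 \<cdot>\<^sub>v v"
      using v'(3) assoc_mult_mat_vec[of "transpose_mat M" n n M n v] M v'(1) by simp
    finally show ?thesis using pos by (simp add: smult_smult_assoc s_def power2_eq_square)
  qed
  ultimately show ?thesis
    using that[OF v'(1) _ u] v' by (simp add: s_def vnorm_def)
qed

lemma gap_bound:
  fixes A :: "real mat"
  assumes A: "A \<in> carrier_mat n n" and n: "n \<ge> 2" and v: "first_unit_singular_vector A v"
    and pos: "singular_value A 1 > 0"
    and x: "x \<in> carrier_vec n" "vnorm x = 1" and y: "y \<in> carrier_vec n" "vnorm y = 1"
  shows "y \<bullet> (A *\<^sub>v x) \<le> singular_value A 1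
    - (singular_value A 1 - singular_value A 2) * (1 - (v \<bullet> x)\<^sup>2) / 2"
proof -
  define s1 s2 where "s1 = singular_value A 1" and "s2 = singular_value A 2"
  note sv = singular_value_2[OF A n v, folded s1_def s2_def]
  obtain u where u: "v \<in> carrier_vec n" "vnorm v = 1" "u \<in> carrier_vec n" "vnorm u = 1"
    "A *\<^sub>v v = s1 \<cdot>\<^sub>v u" "transpose_mat A *\<^sub>v u = s1 \<cdot>\<^sub>v v"
    using first_unit_singular_vectorD[OF A v pos] unfolding s1_def by metis
  have s1: "s1 > 0" using pos by (simp add: s1_def)
  have sq: "v \<bullet> v = 1" "u \<bullet> u = 1" "x \<bullet> x = 1" "y \<bullet> y = 1"
    using u x y by (simp_all flip: vnorm_square)
  define c d where "c = v \<bullet> x" and "d = u \<bullet> y"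
  have c': "x \<bullet> v = c" "y \<bullet> u = d"
    using comm_scalar_prod u x y by (auto simp: c_def d_def)
  define w where "w = x - c \<cdot>\<^sub>v v"
  define z where "z = y - d \<cdot>\<^sub>v u"
  have wz: "w \<in> carrier_vec n" "z \<in> carrier_vec n" using u x y by (auto simp: w_def z_def)
  have wv: "w \<bullet> v = 0"
    using u x sq c' by (simp add: w_def minus_scalar_prod_distrib[of _ n])
  have zu: "z \<bullet> u = 0"
    using u y sq c' by (simp add: z_def minus_scalar_prod_distrib[of _ n])
  have nw: "(vnorm w)\<^sup>2 = 1 - c\<^sup>2"
    unfolding vnorm_square unfolding w_def power2_eq_square using u x sq c' c_def[symmetric]
    by (simp add: minus_scalar_prod_distrib[of _ n] scalar_prod_minus_distrib[of _ n])
  have nz: "(vnorm z)\<^sup>2 = 1 - d\<^sup>2"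
    unfolding vnorm_square unfolding z_def power2_eq_square using u y sq c' d_def[symmetric]
    by (simp add: minus_scalar_prod_distrib[of _ n] scalar_prod_minus_distrib[of _ n])
  have zAv: "z \<bullet> (A *\<^sub>v v) = 0" using u zu wz by simp
  have uAw: "u \<bullet> (A *\<^sub>v w) = 0"
    using scalar_prod_adjoint[OF A u(3) wz(1)] u wz wv comm_scalar_prod[OF wz(1) u(1)] by simp
  have uAv: "u \<bullet> (A *\<^sub>v v) = s1" using u sq by simp
  have xw: "x = c \<cdot>\<^sub>v v + w" using u x by (intro eq_vecI) (auto simp: w_def)
  have yz: "y = d \<cdot>\<^sub>v u + z" using u y by (intro eq_vecI) (auto simp: z_def)
  have Ax: "A *\<^sub>v x = c \<cdot>\<^sub>v (A *\<^sub>v v) + A *\<^sub>v w"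
    using A u wz by (subst xw) (simp add: mult_add_distrib_mat_vec[OF A] mult_mat_vec[OF A])
  have "y \<bullet> (A *\<^sub>v x) = c * (y \<bullet> (A *\<^sub>v v)) + y \<bullet> (A *\<^sub>v w)"
    using A u y wz by (simp add: Ax scalar_prod_add_distrib[of _ n])
  also have "y \<bullet> (A *\<^sub>v v) = d * (u \<bullet> (A *\<^sub>v v)) + z \<bullet> (A *\<^sub>v v)"
    using A u wz by (subst yz) (simp add: add_scalar_prod_distrib[of _ n] distrib_left mult_ac)
  also have "y \<bullet> (A *\<^sub>v w) = d * (u \<bullet> (A *\<^sub>v w)) + z \<bullet> (A *\<^sub>v w)"
    using A u wz by (subst yz) (simp add: add_scalar_prod_distrib[of _ n] distrib_left mult_ac)
  finally have "y \<bullet> (A *\<^sub>v x) = s1 * (c * d) + z \<bullet> (A *\<^sub>v w)"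
    by (simp add: zAv uAw uAv mult_ac)
  also have "z \<bullet> (A *\<^sub>v w) \<le> vnorm z * vnorm (A *\<^sub>v w)"
    using vec_Cauchy_Schwarz[of z n "A *\<^sub>v w"] A wz by auto
  also have "\<dots> \<le> vnorm z * (s2 * vnorm w)"
    using sv(3)[OF wz(1) wv] by (intro mult_left_mono) auto
  also have "\<dots> = s2 * (vnorm z * vnorm w)" by simp
  also have "\<dots> \<le> s2 * (((1 - d\<^sup>2) + (1 - c\<^sup>2)) / 2)"
    using sum_squares_bound[of "vnorm z" "vnorm w"] nw nz sv(1)
    by (intro mult_left_mono) (auto simp: mult.assoc)
  also have "s1 * (c * d) \<le> s1 * ((c\<^sup>2 + d\<^sup>2) / 2)"
    using sum_squares_bound[of c d] s1 by (intro mult_left_mono) (auto simp: mult.assoc)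
  finally have "y \<bullet> (A *\<^sub>v x) \<le> s1 * ((c\<^sup>2 + d\<^sup>2) / 2) + s2 * (((1 - d\<^sup>2) + (1 - c\<^sup>2)) / 2)"
    by simp
  also have "\<dots> = s1 - (s1 - s2) * (1 - c\<^sup>2) / 2 - (s1 - s2) * (1 - d\<^sup>2) / 2"
    by (simp add: field_simps)
  also have "\<dots> \<le> s1 - (s1 - s2) * (1 - c\<^sup>2) / 2"
  proof -
    have "0 \<le> 1 - d\<^sup>2" using nz zero_le_power2[of "vnorm z"] by linarith
    then show ?thesis using sv(2) by simp
  qed
  finally show ?thesis by (simp add: s1_def s2_def c_def)
qed

lemma singular_vector_perturbation:
  fixes A E :: "real mat"
  assumes A: "A \<in> carrier_mat n n" and E: "E \<in> carrier_mat n n" and n: "n \<ge> 2"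
    and v: "first_unit_singular_vector A v" and v': "first_unit_singular_vector (A + E) v'"
    and Q: "orthonormal_cols n k Q" and QA: "Q * (transpose_mat Q * A) = A"
    and P: "orthonormal_cols n l P" and PA: "P * (transpose_mat P * transpose_mat A) = transpose_mat A"
    and T: "\<And>x y. x \<in> carrier_vec k \<Longrightarrow> y \<in> carrier_vec l \<Longrightarrow>
      \<bar>(Q *\<^sub>v x) \<bullet> (E *\<^sub>v (P *\<^sub>v y))\<bar> \<le> T * vnorm x * vnorm y" and T0: "T \<ge> 0"
    and L: "\<And>x y. x \<in> carrier_vec n \<Longrightarrow> y \<in> carrier_vec n \<Longrightarrow>
      \<bar>x \<bullet> (E *\<^sub>v y)\<bar> \<le> L * vnorm x * vnorm y" and L0: "L \<ge> 0"
    and pos: "singular_value A 1 > 0" and large: "2 * L \<le> singular_value A 1"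
  shows "(singular_value A 1 - singular_value A 2) * (1 - (v \<bullet> v')\<^sup>2)
    \<le> 4 * T + 8 * L\<^sup>2 / singular_value A 1"
proof -
  define s1 s2 s where "s1 = singular_value A 1" and "s2 = singular_value A 2"
    and "s = singular_value (A + E) 1"
  have M: "A + E \<in> carrier_mat n n" using A E by simp
  have s1: "s1 > 0" using pos by (simp add: s1_def)
  note QC = orthonormal_cols_carrier[OF Q] and PC = orthonormal_cols_carrier[OF P]
  obtain u where u: "v \<in> carrier_vec n" "vnorm v = 1" "u \<in> carrier_vec n" "vnorm u = 1"
    "A *\<^sub>v v = s1 \<cdot>\<^sub>v u" "transpose_mat A *\<^sub>v u = s1 \<cdot>\<^sub>v v"
    using first_unit_singular_vectorD[OF A v pos] unfolding s1_def by metis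
  have vv: "v \<bullet> v = 1" "u \<bullet> u = 1" using u by (simp_all flip: vnorm_square)
  have Qu: "Q *\<^sub>v (transpose_mat Q *\<^sub>v u) = u"
  proof -
    have "u = A *\<^sub>v ((1 / s1) \<cdot>\<^sub>v v)"
      using A u s1 by (simp add: mult_mat_vec[OF A] smult_smult_assoc)
    then show ?thesis using orthonormal_cols_range[OF Q A QA, of "(1 / s1) \<cdot>\<^sub>v v"] u by simp
  qed
  have At: "transpose_mat A \<in> carrier_mat n n" and Et: "transpose_mat E \<in> carrier_mat n n"
    using A E by auto
  have Pv: "P *\<^sub>v (transpose_mat P *\<^sub>v v) = v"
  proof -
    have "v = transpose_mat A *\<^sub>v ((1 / s1) \<cdot>\<^sub>v u)"
      using A u s1 by (simp add: mult_mat_vec[OF At] smult_smult_assoc)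
    then show ?thesis using orthonormal_cols_range[OF P At PA, of "(1 / s1) \<cdot>\<^sub>v u"] u by simp
  qed
  have TE: "\<bar>(Q *\<^sub>v (transpose_mat Q *\<^sub>v x)) \<bullet> (E *\<^sub>v (P *\<^sub>v (transpose_mat P *\<^sub>v y)))\<bar> \<le> T"
    if x: "x \<in> carrier_vec n" "vnorm x = 1" and y: "y \<in> carrier_vec n" "vnorm y = 1" for x y
  proof -
    have "\<bar>(Q *\<^sub>v (transpose_mat Q *\<^sub>v x)) \<bullet> (E *\<^sub>v (P *\<^sub>v (transpose_mat P *\<^sub>v y)))\<bar>
      \<le> T * (vnorm (transpose_mat Q *\<^sub>v x) * vnorm (transpose_mat P *\<^sub>v y))"
      using T[of "transpose_mat Q *\<^sub>v x" "transpose_mat P *\<^sub>v y"] QC PC x y by (simp add: mult.assoc)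
    also have "\<dots> \<le> T * (1 * 1)"
      using orthonormal_cols_transpose_contraction[OF Q x(1)]
        orthonormal_cols_transpose_contraction[OF P y(1)] x y T0
      by (intro mult_left_mono mult_mono) auto
    finally show ?thesis by simp
  qed
  have "s1 + u \<bullet> (E *\<^sub>v v) = u \<bullet> ((A + E) *\<^sub>v v)"
    using A E u vv by (simp add: add_mult_distrib_mat_vec[OF A E] scalar_prod_add_distrib[of _ n])
  also have "\<dots> \<le> vnorm ((A + E) *\<^sub>v v)"
    using vec_Cauchy_Schwarz[of u n "(A + E) *\<^sub>v v"] M u by auto
  also have "\<dots> \<le> s"
    using singular_value_1(2)[OF M _ u(1)] u n by (simp add: s_def)
  finally have lower: "s1 + u \<bullet> (E *\<^sub>v v) \<le> s" .
  have uEv: "\<bar>u \<bullet> (E *\<^sub>v v)\<bar> \<le> T" "\<bar>u \<bullet> (E *\<^sub>v v)\<bar> \<le> L"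
    using TE[OF u(3,4) u(1,2)] L[OF u(3) u(1)] u by (simp_all add: Qu Pv)
  have half: "s1 / 2 \<le> s" using lower uEv(2) large by (simp add: s1_def)
  then have s: "s > 0" using s1 by simp
  obtain u' where u': "v' \<in> carrier_vec n" "vnorm v' = 1" "u' \<in> carrier_vec n" "vnorm u' = 1"
    "(A + E) *\<^sub>v v' = s \<cdot>\<^sub>v u'" "transpose_mat (A + E) *\<^sub>v u' = s \<cdot>\<^sub>v v'"
    using first_unit_singular_vectorD[OF M v'] s unfolding s_def by metis
  have Ls: "L / s \<le> 2 * L / s1"
    using frac_le[OF L0 order_refl, of "s1 / 2" s] half s1 by (simp add: mult.commute)
  define a b where "a = Q *\<^sub>v (transpose_mat Q *\<^sub>v u')" and "b = P *\<^sub>v (transpose_mat P *\<^sub>v v')"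
  have ab: "a \<in> carrier_vec n" "b \<in> carrier_vec n" using QC PC u' by (auto simp: a_def b_def)
  have ru: "vnorm (u' - a) \<le> 2 * L / s1"
    using residual_bound[OF A E Q QA u'(1,2,3,5) s L L0] Ls by (simp add: a_def)
  have Lt: "\<bar>x \<bullet> (transpose_mat E *\<^sub>v y)\<bar> \<le> L * vnorm x * vnorm y"
    if "x \<in> carrier_vec n" "y \<in> carrier_vec n" for x y
    using L[OF that(2,1)] scalar_prod_adjoint[OF E that(2,1)] comm_scalar_prod[OF that(1), of "transpose_mat E *\<^sub>v y"]
      E that by (simp add: mult_ac)
  have "(transpose_mat A + transpose_mat E) *\<^sub>v u' = s \<cdot>\<^sub>v v'"
    using u'(6) transpose_add[OF A E] by simp
  from residual_bound[OF At Et P PA u'(3,4,1) this s Lt L0]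
  have rv: "vnorm (v' - b) \<le> 2 * L / s1"
    using Ls by (simp add: b_def)
  have na: "vnorm a \<le> 1"
    using orthonormal_cols_vnorm[OF Q, of "transpose_mat Q *\<^sub>v u'"]
      orthonormal_cols_transpose_contraction[OF Q u'(3)] QC u' by (simp add: a_def)
  have "u' \<bullet> (E *\<^sub>v v') = a \<bullet> (E *\<^sub>v b) + a \<bullet> (E *\<^sub>v (v' - b)) + (u' - a) \<bullet> (E *\<^sub>v v')"
    using E u' ab by (simp add: mult_minus_distrib_mat_vec[OF E] scalar_prod_minus_distrib[of _ n]
        minus_scalar_prod_distrib[of _ n])
  moreover have "a \<bullet> (E *\<^sub>v b) \<le> T"
    using TE[OF u'(3,4) u'(1,2)] by (simp add: a_def b_def)
  moreover have "a \<bullet> (E *\<^sub>v (v' - b)) \<le> L * (2 * L / s1)"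
  proof -
    have "a \<bullet> (E *\<^sub>v (v' - b)) \<le> L * (vnorm a * vnorm (v' - b))"
      using L[of a "v' - b"] ab u' by (auto simp: mult.assoc)
    also have "\<dots> \<le> L * (1 * (2 * L / s1))"
      using na rv L0 by (intro mult_left_mono mult_mono) auto
    finally show ?thesis by simp
  qed
  moreover have "(u' - a) \<bullet> (E *\<^sub>v v') \<le> L * (2 * L / s1)"
  proof -
    have "(u' - a) \<bullet> (E *\<^sub>v v') \<le> L * vnorm (u' - a)"
      using L[of "u' - a" v'] ab u' by auto
    also have "\<dots> \<le> L * (2 * L / s1)"
      using ru L0 by (intro mult_left_mono) auto
    finally show ?thesis .
  qed
  ultimately have Euv: "u' \<bullet> (E *\<^sub>v v') \<le> T + 4 * L\<^sup>2 / s1"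
    by (simp add: power2_eq_square)
  have "s = u' \<bullet> ((A + E) *\<^sub>v v')"
    using u' by (simp flip: vnorm_square)
  also have "\<dots> = u' \<bullet> (A *\<^sub>v v') + u' \<bullet> (E *\<^sub>v v')"
    unfolding add_mult_distrib_mat_vec[OF A E u'(1)]
    by (rule scalar_prod_add_distrib[of _ n]) (use A E u' in auto)
  finally have "s1 - T \<le> s1 - (s1 - s2) * (1 - (v \<bullet> v')\<^sup>2) / 2 + (T + 4 * L\<^sup>2 / s1)"
    using gap_bound[OF A n v pos u'(1-4)] Euv lower uEv(1) unfolding s1_def s2_def by linarith
  then have "(s1 - s2) * (1 - (v \<bullet> v')\<^sup>2) \<le> 4 * T + 2 * (4 * L\<^sup>2 / s1)"
    by simp
  then show ?thesis by (simp add: s1_def s2_def)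
qed

lemma sin_unit_vec_angle_square:
  assumes "v \<in> carrier_vec n" "w \<in> carrier_vec n" "vnorm v = 1" "vnorm w = 1"
  shows "(sin (unit_vec_angle v w))\<^sup>2 = 1 - (v \<bullet> w)\<^sup>2"
proof -
  have "\<bar>v \<bullet> w\<bar> \<le> 1" using vec_Cauchy_Schwarz[OF assms(1,2)] assms(3,4) by simp
  then have "sin (unit_vec_angle v w) = sqrt (1 - (v \<bullet> w)\<^sup>2)"
    unfolding unit_vec_angle_def by (subst sin_arccos) auto
  moreover have "(v \<bullet> w)\<^sup>2 \<le> 1" using \<open>\<bar>v \<bullet> w\<bar> \<le> 1\<close> by (simp add: abs_square_le_1)
  ultimately show ?thesis by simp
qed

lemma orthonormal_cols_one: "orthonormal_cols n n (1\<^sub>m n)"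
  by (simp add: orthonormal_cols_def)

lemma bernoulli_subspace_tail_le:
  assumes n: "n \<ge> 2" and Q: "orthonormal_cols n k Q" and P: "orthonormal_cols n l P"
    and kl: "k \<le> m" "l \<le> m" and b: "b > 0" "36 * real m + ln (real n) \<le> 72 * b"
  shows "measure_pmf.prob (bernoulli_matrix n)
      {E. \<exists>x\<in>carrier_vec k. \<exists>y\<in>carrier_vec l.
          24 * sqrt b * vnorm x * vnorm y < \<bar>(Q *\<^sub>v x) \<bullet> (E *\<^sub>v (P *\<^sub>v y))\<bar>}
    \<le> 2 / real n"
proof -
  have "measure_pmf.prob (bernoulli_matrix n)
      {E. \<exists>x\<in>carrier_vec k. \<exists>y\<in>carrier_vec l.
          2 * (12 * sqrt b) * vnorm x * vnorm y < \<bar>(Q *\<^sub>v x) \<bullet> (E *\<^sub>v (P *\<^sub>v y))\<bar>}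
    \<le> 2 * exp (18 * real (k + l) - (12 * sqrt b)\<^sup>2 / 2)"
    using b(1) by (intro bernoulli_subspace_tail[OF Q P]) simp
  also have "\<dots> \<le> 2 * exp (- ln (real n))"
    using b kl by (simp add: power_mult_distrib)
  also have "\<dots> = 2 / real n"
    using n by (simp add: exp_minus field_simps)
  finally show ?thesis by simp
qed

lemma bernoulli_good_event:
  assumes n: "n \<ge> 2" and Q: "orthonormal_cols n k Q" and P: "orthonormal_cols n l P"
    and kl: "k \<le> r" "l \<le> r" and r: "r > 0"
  shows "measure_pmf.prob (bernoulli_matrix n)
      {E \<in> carrier_mat n n.
        (\<forall>x\<in>carrier_vec k. \<forall>y\<in>carrier_vec l. \<bar>(Q *\<^sub>v x) \<bullet> (E *\<^sub>v (P *\<^sub>v y))\<bar>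
          \<le> 24 * sqrt (real r * ln (real n)) * vnorm x * vnorm y) \<and>
        (\<forall>x\<in>carrier_vec n. \<forall>y\<in>carrier_vec n. \<bar>x \<bullet> (E *\<^sub>v y)\<bar>
          \<le> 24 * sqrt (real n) * vnorm x * vnorm y)}
    \<ge> 1 - 4 / real n"
    (is "measure_pmf.prob ?M ?G \<ge> _")
proof -
  have ln2: "2 / 3 \<le> ln (real n)"
    using ln2_ge_two_thirds n by (intro order_trans[OF ln2_ge_two_thirds]) simp
  have rn: "real r * (2 / 3) \<le> real r * ln (real n)"
    using ln2 by (intro mult_left_mono) auto
  have rl: "1 * ln (real n) \<le> real r * ln (real n)"
    using r ln2 by (intro mult_right_mono) auto
  have lnn: "ln (real n) \<le> real n" using ln_le_minus_one[of "real n"] n by simp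
  define B1 where "B1 = {E. \<exists>x\<in>carrier_vec k. \<exists>y\<in>carrier_vec l.
    24 * sqrt (real r * ln (real n)) * vnorm x * vnorm y < \<bar>(Q *\<^sub>v x) \<bullet> (E *\<^sub>v (P *\<^sub>v y))\<bar>}"
  define B2 where "B2 = {E. \<exists>x\<in>carrier_vec n. \<exists>y\<in>carrier_vec n.
    24 * sqrt (real n) * vnorm x * vnorm y < \<bar>(1\<^sub>m n *\<^sub>v x) \<bullet> (E *\<^sub>v (1\<^sub>m n *\<^sub>v y))\<bar>}"
  have "36 * real r + ln (real n) \<le> 72 * (real r * ln (real n))"
    using rn rl by linarith
  moreover have "0 < real r * ln (real n)" using r ln2 by simp
  ultimately have B1: "measure_pmf.prob ?M B1 \<le> 2 / real n"
    unfolding B1_def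
    by (intro bernoulli_subspace_tail_le[OF n Q P kl])
  have B2: "measure_pmf.prob ?M B2 \<le> 2 / real n"
    unfolding B2_def
    by (rule bernoulli_subspace_tail_le[OF n orthonormal_cols_one orthonormal_cols_one order_refl order_refl])
       (use n lnn in auto)
  have "measure_pmf.prob ?M (- ?G) \<le> measure_pmf.prob ?M (B1 \<union> B2)"
  proof (rule measure_pmf.finite_measure_mono_AE)
    show "AE E in ?M. E \<in> - ?G \<longrightarrow> E \<in> B1 \<union> B2"
    proof (rule AE_pmfI, rule impI)
      fix E assume "E \<in> set_pmf ?M" "E \<in> - ?G"
      moreover from this have "E \<in> carrier_mat n n" using set_pmf_bernoulli_matrix[of n] by blast
      ultimately show "E \<in> B1 \<union> B2" by (force simp: B1_def B2_def not_le)
    qed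
  qed simp
  also have "\<dots> \<le> measure_pmf.prob ?M B1 + measure_pmf.prob ?M B2"
    by (rule measure_Un_le) auto
  also have "\<dots> \<le> 4 / real n" using B1 B2 by simp
  finally show ?thesis
    using measure_pmf.prob_compl[of ?G ?M] by (simp add: Compl_eq_Diff_UNIV)
qed

lemma first_singular_vector_rank_pos:
  assumes A: "A \<in> carrier_mat n n" and v: "first_unit_singular_vector A v"
    and pos: "singular_value A 1 > 0"
    and Q: "orthonormal_cols n k Q" and QA: "Q * (transpose_mat Q * A) = A"
  shows "k > 0"
proof (rule ccontr)
  assume "\<not> k > 0"
  then have k: "k = 0" by simp
  note C = orthonormal_cols_carrier[OF Q]
  obtain u where u: "v \<in> carrier_vec n" "u \<in> carrier_vec n" "vnorm u = 1" "A *\<^sub>v v = singular_value A 1 \<cdot>\<^sub>v u"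
    using first_unit_singular_vectorD[OF A v pos] by metis
  define z where "z = transpose_mat Q *\<^sub>v (A *\<^sub>v v)"
  have z: "z \<in> carrier_vec k" using C A u by (simp add: z_def)
  have "vnorm (A *\<^sub>v v) = vnorm z"
    using orthonormal_cols_range[OF Q A QA u(1)] orthonormal_cols_vnorm[OF Q z] by (simp add: z_def)
  also have "\<dots> = 0" using z k by (simp add: vnorm_def scalar_prod_self)
  finally show False using u pos by (simp add: vnorm_smult)
qed

lemma sin_angle_bound:
  fixes A E :: "real mat"
  assumes A: "A \<in> carrier_mat n n" and E: "E \<in> carrier_mat n n" and n: "n \<ge> 2"
    and v: "first_unit_singular_vector A v" and v': "first_unit_singular_vector (A + E) v'"
    and Q: "orthonormal_cols n k Q" and QA: "Q * (transpose_mat Q * A) = A"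
    and P: "orthonormal_cols n l P" and PA: "P * (transpose_mat P * transpose_mat A) = transpose_mat A"
    and T: "\<And>x y. x \<in> carrier_vec k \<Longrightarrow> y \<in> carrier_vec l \<Longrightarrow>
      \<bar>(Q *\<^sub>v x) \<bullet> (E *\<^sub>v (P *\<^sub>v y))\<bar> \<le> T * vnorm x * vnorm y" and T0: "T \<ge> 0"
    and L: "\<And>x y. x \<in> carrier_vec n \<Longrightarrow> y \<in> carrier_vec n \<Longrightarrow>
      \<bar>x \<bullet> (E *\<^sub>v y)\<bar> \<le> L * vnorm x * vnorm y" and L0: "L \<ge> 0"
    and gap: "singular_value A 2 < singular_value A 1"
  defines "\<delta> \<equiv> singular_value A 1 - singular_value A 2"
  shows "(sin (unit_vec_angle v v'))\<^sup>2 \<le> 4 * (T / \<delta>) + 8 * (L\<^sup>2 / (\<delta> * singular_value A 1))"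
proof -
  define s where "s = singular_value A 1"
  have M: "A + E \<in> carrier_mat n n" using A E by simp
  have s2: "0 \<le> singular_value A 2" by (rule singular_value_2(1)[OF A n v])
  then have s: "0 < s" "0 < \<delta>" "\<delta> \<le> s" using gap by (auto simp: s_def \<delta>_def)
  have unit: "v \<in> carrier_vec n" "vnorm v = 1" "v' \<in> carrier_vec n" "vnorm v' = 1"
    using v v' A M by (auto simp: first_unit_singular_vector_def eigenvector_def vnorm_def)
  have sin: "(sin (unit_vec_angle v v'))\<^sup>2 = 1 - (v \<bullet> v')\<^sup>2"
    using unit by (intro sin_unit_vec_angle_square) auto
  show ?thesis
  proof (cases "2 * L \<le> s")
    case True
    have "\<delta> * (1 - (v \<bullet> v')\<^sup>2) \<le> 4 * T + 8 * L\<^sup>2 / s"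
      unfolding \<delta>_def s_def
      by (rule singular_vector_perturbation[OF A E n v v' Q QA P PA T T0 L L0])
         (use s True in \<open>auto simp: s_def\<close>)
    then have "1 - (v \<bullet> v')\<^sup>2 \<le> (4 * T + 8 * L\<^sup>2 / s) / \<delta>"
      using s by (simp add: pos_le_divide_eq mult.commute)
    also have "\<dots> = 4 * (T / \<delta>) + 8 * (L\<^sup>2 / (\<delta> * s))"
      using s by (simp add: add_divide_distrib mult.commute)
    finally show ?thesis by (simp add: sin s_def)
  next
    case False
    have "\<delta> * s \<le> s\<^sup>2" using s by (simp add: power2_eq_square)
    also have "s\<^sup>2 \<le> (2 * L)\<^sup>2" using False s by (intro power_mono) auto
    finally have "\<delta> * s \<le> 4 * L\<^sup>2" by (simp add: power_mult_distrib)
    then have "\<delta> * s \<le> 8 * L\<^sup>2" using zero_le_power2[of L] by linarith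
    then have "1 \<le> 8 * (L\<^sup>2 / (\<delta> * s))" using s by (simp add: pos_le_divide_eq)
    moreover have "0 \<le> 4 * (T / \<delta>)" using T0 s by simp
    moreover have "1 - (v \<bullet> v')\<^sup>2 \<le> 1" by simp
    ultimately show ?thesis unfolding sin s_def[symmetric] by linarith
  qed
qed

theorem theorem8:
  fixes \<alpha>\<^sub>1 \<alpha>\<^sub>2 :: real
  assumes "\<alpha>\<^sub>1 > 0" and "\<alpha>\<^sub>2 > 0"
  shows "\<exists>C>0. \<exists>p :: nat \<Rightarrow> real. p \<longlonglongrightarrow> 0 \<and>
    (\<forall>n\<ge>2. \<forall>A \<in> carrier_mat n n. \<forall>r \<sigma>\<^sub>1 \<sigma>\<^sub>2 \<delta> v\<^sub>1.
       r = vec_space.rank n A \<longrightarrow>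
       \<sigma>\<^sub>1 = singular_value A 1 \<longrightarrow> \<sigma>\<^sub>2 = singular_value A 2 \<longrightarrow>
       \<delta> = \<sigma>\<^sub>1 - \<sigma>\<^sub>2 \<longrightarrow> \<delta> > 0 \<longrightarrow>
       real r \<le> real n powr (1 - \<alpha>\<^sub>1) \<longrightarrow>
       \<sigma>\<^sub>1 \<le> real n powr \<alpha>\<^sub>2 \<longrightarrow>
       first_unit_singular_vector A v\<^sub>1 \<longrightarrow>
       measure_pmf.prob (bernoulli_matrix n)
         {E. \<forall>v\<^sub>1'. first_unit_singular_vector (A + E) v\<^sub>1' \<longrightarrow>
           (sin (unit_vec_angle v\<^sub>1 v\<^sub>1'))\<^sup>2 \<le>
             C * Max {sqrt (real r * ln (real n)) / \<delta>, real n / (\<delta> * \<sigma>\<^sub>1), sqrt (real n) / \<sigma>\<^sub>1}}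
         \<ge> 1 - p n \<and>
       (\<delta> \<le> \<sigma>\<^sub>1 / 2 \<longrightarrow>
        measure_pmf.prob (bernoulli_matrix n)
         {E. \<forall>v\<^sub>1'. first_unit_singular_vector (A + E) v\<^sub>1' \<longrightarrow>
           (sin (unit_vec_angle v\<^sub>1 v\<^sub>1'))\<^sup>2 \<le>
             C * Max {sqrt (real r * ln (real n)) / \<delta>, real n / (\<delta> * \<sigma>\<^sub>1)}}
         \<ge> 1 - p n))"
proof (intro exI[of _ "4704 :: real"] conjI exI[of _ "\<lambda>n. 4 / real n"] allI ballI impI)
  show "(\<lambda>n. 4 / real n) \<longlonglongrightarrow> 0" by (rule lim_const_over_n)
next
  fix n :: nat and A r \<sigma>\<^sub>1 \<sigma>\<^sub>2 \<delta> v\<^sub>1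
  assume n: "n \<ge> 2" and A: "A \<in> carrier_mat n n" and r: "r = vec_space.rank n A"
    and \<sigma>: "\<sigma>\<^sub>1 = singular_value A 1" "\<sigma>\<^sub>2 = singular_value A 2" and \<delta>: "\<delta> = \<sigma>\<^sub>1 - \<sigma>\<^sub>2" "\<delta> > 0"
    and v: "first_unit_singular_vector A v\<^sub>1"
  let ?X = "sqrt (real r * ln (real n)) / \<delta>" and ?Y = "real n / (\<delta> * \<sigma>\<^sub>1)"
  obtain k l Q P where kl: "k \<le> r" "l \<le> r" and Q: "orthonormal_cols n k Q"
    and P: "orthonormal_cols n l P" and QA: "Q * (transpose_mat Q * A) = A"
    and PA: "P * (transpose_mat P * transpose_mat A) = transpose_mat A"
    using ex_singular_subspaces[OF A] unfolding r by metis
  have pos: "singular_value A 1 > 0"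
    using singular_value_2(1)[OF A n v] \<delta> \<sigma> by simp
  have rpos: "r > 0" using first_singular_vector_rank_pos[OF A v pos Q QA] kl by simp
  let ?G = "{E \<in> carrier_mat n n.
      (\<forall>x\<in>carrier_vec k. \<forall>y\<in>carrier_vec l. \<bar>(Q *\<^sub>v x) \<bullet> (E *\<^sub>v (P *\<^sub>v y))\<bar>
        \<le> 24 * sqrt (real r * ln (real n)) * vnorm x * vnorm y) \<and>
      (\<forall>x\<in>carrier_vec n. \<forall>y\<in>carrier_vec n. \<bar>x \<bullet> (E *\<^sub>v y)\<bar>
        \<le> 24 * sqrt (real n) * vnorm x * vnorm y)}"
  note good = bernoulli_good_event[OF n Q P kl rpos]
  have lnn: "0 \<le> ln (real n)" using n by simp
  have bound: "(sin (unit_vec_angle v\<^sub>1 v\<^sub>1'))\<^sup>2 \<le> 96 * ?X + 4608 * ?Y"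
    if E: "E \<in> ?G"
      and v': "first_unit_singular_vector (A + E) v\<^sub>1'" for E v\<^sub>1'
  proof -
    from E have "E \<in> carrier_mat n n"
      and "\<forall>x\<in>carrier_vec k. \<forall>y\<in>carrier_vec l. \<bar>(Q *\<^sub>v x) \<bullet> (E *\<^sub>v (P *\<^sub>v y))\<bar>
        \<le> 24 * sqrt (real r * ln (real n)) * vnorm x * vnorm y"
      and "\<forall>x\<in>carrier_vec n. \<forall>y\<in>carrier_vec n. \<bar>x \<bullet> (E *\<^sub>v y)\<bar>
        \<le> 24 * sqrt (real n) * vnorm x * vnorm y"
      by blast+
    note E' = this
    have "(sin (unit_vec_angle v\<^sub>1 v\<^sub>1'))\<^sup>2 \<le> 4 * (24 * sqrt (real r * ln (real n)) / \<delta>)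
        + 8 * ((24 * sqrt (real n))\<^sup>2 / (\<delta> * \<sigma>\<^sub>1))"
      unfolding \<delta>(1) \<sigma>
      by (rule sin_angle_bound[OF A E'(1) n v v' Q QA P PA]) (use E' \<delta> \<sigma> lnn in auto)
    then show ?thesis by (simp add: power_mult_distrib)
  qed
  have le: "96 * ?X + 4608 * ?Y \<le> 4704 * Max S" if "finite S" "?X \<in> S" "?Y \<in> S" for S
    using Max_ge[OF that(1,2)] Max_ge[OF that(1,3)] by linarith
  have event: "1 - 4 / real n \<le> measure_pmf.prob (bernoulli_matrix n)
      {E. \<forall>v\<^sub>1'. first_unit_singular_vector (A + E) v\<^sub>1' \<longrightarrow>
        (sin (unit_vec_angle v\<^sub>1 v\<^sub>1'))\<^sup>2 \<le> 4704 * Max S}"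
    if S: "finite S" "?X \<in> S" "?Y \<in> S" for S
  proof (rule order_trans[OF good], rule measure_pmf.finite_measure_mono, rule subsetI)
    fix E assume E: "E \<in> ?G"
    show "E \<in> {E. \<forall>v\<^sub>1'. first_unit_singular_vector (A + E) v\<^sub>1' \<longrightarrow>
        (sin (unit_vec_angle v\<^sub>1 v\<^sub>1'))\<^sup>2 \<le> 4704 * Max S}"
      using order_trans[OF bound[OF E] le[OF S]] by simp
  qed simp
  show "1 - 4 / real n \<le> measure_pmf.prob (bernoulli_matrix n)
      {E. \<forall>v\<^sub>1'. first_unit_singular_vector (A + E) v\<^sub>1' \<longrightarrow>
        (sin (unit_vec_angle v\<^sub>1 v\<^sub>1'))\<^sup>2 \<le> 4704 * Max {?X, ?Y, sqrt (real n) / \<sigma>\<^sub>1}}"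
    by (rule event) auto
  show "1 - 4 / real n \<le> measure_pmf.prob (bernoulli_matrix n)
      {E. \<forall>v\<^sub>1'. first_unit_singular_vector (A + E) v\<^sub>1' \<longrightarrow>
        (sin (unit_vec_angle v\<^sub>1 v\<^sub>1'))\<^sup>2 \<le> 4704 * Max {?X, ?Y}}"
    by (rule event) auto
qed simp

end
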